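(* (i) Let $T:\mathbb{R}[t]_{n,0}\to\mathbb{R}[t]_{d,0}$ be a diagonal 0-sum hyperbolicity preserver. If $d\le 4$, then $T$ is extendable. Moreover, for $d\le 4$, a diagonal linear map $T:\mathbb{R}[t]_{n,0}\to\mathbb{R}[t]_{d,0}$ is an (extendable) 0-sum hyperbolicity preserver if and only if $T\big((t-1)^{n-1}(t+n-1)\big)$ has real roots, where $d-1$ of them have the same sign. (ii) If $d\ge 5$, then there exists a diagonal 0-sum hyperbolicity preserver $\mathbb{R}[t]_{n,0}\to\mathbb{R}[t]_{d,0}$ which is not extendable.
   Context: $\mathbb{R}[t]_n$ is the space of real univariate polynomials of degree at most $n$; $\mathbb{R}[t]_{n,0}\subset\mathbb{R}[t]_n$ is the subspace of those whose coefficient of $t^{n-1}$ is $0$. $\mathcal{H}_{n,0}$ is the set of polynomials in $\mathbb{R}[t]_{n,0}$ with only real roots. A linear map $T:\mathbb{R}[t]_{n,0}\to\mathbb{R}[t]_{d,0}$ is a 0-sum hyperbolicity preserver if $T(\mathcal{H}_{n,0})\subseteq\mathcal{H}_{d,0}$. It is diagonal if there are reals $\gamma_k$ such that $T(t^{n-k})=\gamma_k t^{d-k}$ for $0\le k\le d$, $k\ne 1$, and $T(t^{n-k})=0$ for $k>d$. A linear map $\hat T:\mathbb{R}[t]_n\to\mathbb{R}[t]_d$ is diagonal if there are reals $\gamma_0,\dots,\gamma_d$ with $\hat T(t^{n-k})=\gamma_k t^{d-k}$ for $0\le k\le d$ and $\hat T(t^{n-k})=0$ for $k>d$; it is a hyperbolicity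 preserver if it maps every real-rooted polynomial in $\mathbb{R}[t]_n$ to a real-rooted polynomial. A diagonal 0-sum hyperbolicity preserver $T$ is extendable if there is a diagonal hyperbolicity preserver $\hat T:\mathbb{R}[t]_n\to\mathbb{R}[t]_d$ whose restriction to $\mathbb{R}[t]_{n,0}$ is $T$. Roots are counted with multiplicity, and roots "have the same sign" if they are all $\ge 0$ or all $\le 0$.
   Formalization: If the image of the test polynomial has degree below d (γ_0 = 0), "d-1 of them have the same sign" is read as "all of its roots have the same sign"; literally the "iff" fails there, e.g. n=d=2, T(t^2)=0, T(1)=1, whose image -1 has no roots. *)

theory Defs
  imports "HOL-Computational_Algebra.Computational_Algebra"
begin

definition polys_upto :: "nat \<Rightarrow> real poly set" where
  "polys_upto n = {p. degree p \<le> n}"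

(* "Suc k = n" rather than "coeff p (n - 1)": for n = 0 there is no coefficient of t^(n-1). *)
definition polys_upto0 :: "nat \<Rightarrow> real poly set" where
  "polys_upto0 n = {p \<in> polys_upto n. \<forall>k. Suc k = n \<longrightarrow> coeff p k = 0}"

(* The zero polynomial counts as real-rooted. Otherwise no diagonal map with d < n - 1 could be
   a preserver, since it sends the constant 1 to 0. *)
definition real_rooted :: "real poly \<Rightarrow> bool" where
  "real_rooted p \<longleftrightarrow>
     p = 0 \<or> (\<forall>z. poly (map_poly complex_of_real p) z = 0 \<longrightarrow> z \<in> \<real>)"

definition hyp0 :: "nat \<Rightarrow> real poly set" where
  "hyp0 n = {p \<in> polys_upto0 n. real_rooted p}"

(* A linear map V \<rightarrow> W between subspaces is represented by a function on all polynomials;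
   its values outside V are irrelevant. *)
definition linear_map_between ::
    "real poly set \<Rightarrow> real poly set \<Rightarrow> (real poly \<Rightarrow> real poly) \<Rightarrow> bool" where
  "linear_map_between V W T \<longleftrightarrow>
     (\<forall>p\<in>V. T p \<in> W) \<and>
     (\<forall>p\<in>V. \<forall>q\<in>V. T (p + q) = T p + T q) \<and>
     (\<forall>c. \<forall>p\<in>V. T (smult c p) = smult c (T p))"

definition diagonal0 :: "nat \<Rightarrow> nat \<Rightarrow> (real poly \<Rightarrow> real poly) \<Rightarrow> bool" where
  "diagonal0 n d T \<longleftrightarrow>
     linear_map_between (polys_upto0 n) (polys_upto0 d) T \<and>
     (\<exists>\<gamma> :: nat \<Rightarrow> real.
        (\<forall>k\<le>d. k \<noteq> 1 \<longrightarrow> T (monom 1 (n - k)) = monom (\<gamma> k) (d - k)) \<and>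
        (\<forall>k\<le>n. d < k \<and> k \<noteq> 1 \<longrightarrow> T (monom 1 (n - k)) = 0))"

definition zero_sum_hyperbolicity_preserver ::
    "nat \<Rightarrow> nat \<Rightarrow> (real poly \<Rightarrow> real poly) \<Rightarrow> bool" where
  "zero_sum_hyperbolicity_preserver n d T \<longleftrightarrow>
     linear_map_between (polys_upto0 n) (polys_upto0 d) T \<and> T ` hyp0 n \<subseteq> hyp0 d"

definition diagonal :: "nat \<Rightarrow> nat \<Rightarrow> (real poly \<Rightarrow> real poly) \<Rightarrow> bool" where
  "diagonal n d T \<longleftrightarrow>
     linear_map_between (polys_upto n) (polys_upto d) T \<and>
     (\<exists>\<gamma> :: nat \<Rightarrow> real.
        (\<forall>k\<le>d. T (monom 1 (n - k)) = monom (\<gamma> k) (d - k)) \<and>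
        (\<forall>k\<le>n. d < k \<longrightarrow> T (monom 1 (n - k)) = 0))"

definition hyperbolicity_preserver ::
    "nat \<Rightarrow> nat \<Rightarrow> (real poly \<Rightarrow> real poly) \<Rightarrow> bool" where
  "hyperbolicity_preserver n d T \<longleftrightarrow>
     linear_map_between (polys_upto n) (polys_upto d) T \<and>
     (\<forall>p\<in>polys_upto n. real_rooted p \<longrightarrow> real_rooted (T p))"

definition extendable :: "nat \<Rightarrow> nat \<Rightarrow> (real poly \<Rightarrow> real poly) \<Rightarrow> bool" where
  "extendable n d T \<longleftrightarrow>
     (\<exists>T'. diagonal n d T' \<and> hyperbolicity_preserver n d T' \<and> (\<forall>p\<in>polys_upto0 n. T' p = T p))"

definition roots_same_sign :: "nat \<Rightarrow> real poly \<Rightarrow> bool" where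
  "roots_same_sign m q \<longleftrightarrow>
     m \<le> size {#x \<in># proots q. 0 \<le> x#} \<or> m \<le> size {#x \<in># proots q. x \<le> 0#}"

(* For q in polys_upto0 d: "d - 1 of the d roots of q have the same sign".
   If degree q < d (so degree q \<le> d - 2), then q has d - degree q \<ge> 2 roots at infinity. It is
   a limit of polynomials of degree d in polys_upto0 d, whose roots sum to 0, so roots escape
   both to plus and to minus infinity. Hence one root at infinity has the wrong sign, the others
   can have the right one, and d - 1 roots of the same sign means that all finite roots have the
   same sign. (Counting every root at infinity with either sign would accept
   t^4 + b t^2 + c t + e \<mapsto> b t^2 - e for n = d = 4, which sends (t^2 - 1)^2 to -2 t^2 - 1.
   Not counting them at all would reject the preserver t^4 + b t^2 + c t + e \<mapsto> b t^2.) *)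
definition all_but_one_root_same_sign :: "nat \<Rightarrow> real poly \<Rightarrow> bool" where
  "all_but_one_root_same_sign d q \<longleftrightarrow>
     roots_same_sign (if degree q = d then d - 1 else degree q) q"

end

theory Submission
  imports Defs
begin

text \<open>The diagonal map with weights \<open>\<gamma>\<close> preserves real-rootedness on all polynomials of degree at most
  \<open>n\<close> if the roots of \<open>g = \<Sum>\<^sub>k (-1)\<^sup>k (n choose k) \<gamma>\<^sub>k t\<^bsup>d-k\<^esup>\<close> are real and have the same sign
  (Schur--Szego, by coincidence of polar forms in a half plane). On polynomials with vanishing second
  coefficient, \<open>\<gamma>\<^sub>1\<close> is invisible, and the image of \<open>(t - 1)\<^bsup>n-1\<^esup> (t + n - 1)\<close> is
  \<open>q = t g' - (d - 1) g\<close>, that is, \<open>(g / t\<^bsup>d-1\<^esup>)' = q / t\<^sup>d\<close>. Hence \<open>\<gamma>\<^sub>1\<close> is a constant of integration: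
  for \<open>d \<le> 4\<close> and \<open>q\<close> with \<open>d - 1\<close> roots of the same sign, \<open>g / t\<^bsup>d-1\<^esup>\<close> has at most three relevant
  critical points and a suitable level makes all roots of \<open>g\<close> real. If the sign condition fails, then
  \<open>d = 4\<close> and \<open>t\<^bsup>n-4\<^esup> (t\<^sup>2 - 1)\<^sup>2\<close> has an image with nonreal roots.

  For \<open>d \<ge> 5\<close>, Newton's inequality between the last three coefficients is strict in the absence of the
  second coefficient, which allows a preserver with only the last three weights nonzero that is not
  a preserver on all polynomials, even after adding a weight \<open>\<gamma>\<^sub>1\<close>.\<close>

section \<open>Real-rooted polynomials and polar derivatives\<close>

abbreviation cpoly :: "real poly \<Rightarrow> complex poly" where
  "cpoly \<equiv> map_poly complex_of_real"

lemma cpoly_mult: "cpoly (p * q) = cpoly p * cpoly q"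
  by (rule poly_eqI) (simp add: coeff_map_poly coeff_mult)

lemma cpoly_smult: "cpoly (smult c p) = smult (complex_of_real c) (cpoly p)"
  by (rule poly_eqI) (simp add: coeff_map_poly)

lemma cpoly_add: "cpoly (p + q) = cpoly p + cpoly q"
  by (rule poly_eqI) (simp add: coeff_map_poly)

lemma cpoly_eq_0_iff [simp]: "cpoly p = 0 \<longleftrightarrow> p = 0"
  by (auto simp: poly_eq_iff coeff_map_poly)

lemma degree_cpoly [simp]: "degree (cpoly p) = degree p"
  by (intro degree_map_poly) auto

lemma poly_cpoly_of_real [simp]: "poly (cpoly p) (complex_of_real x) = complex_of_real (poly p x)"
  by (simp add: poly_altdef coeff_map_poly)

lemma poly_cpoly_sum:
  assumes "degree p \<le> n"
  shows "poly (cpoly p) z = (\<Sum>k\<le>n. complex_of_real (coeff p k) * z ^ k)"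
proof -
  have "(\<Sum>k\<le>n. complex_of_real (coeff p k) * z ^ k) =
      (\<Sum>k\<le>degree p. complex_of_real (coeff p k) * z ^ k)"
    using assms by (intro sum.mono_neutral_right) (auto simp: coeff_eq_0)
  then show ?thesis
    by (simp add: poly_altdef coeff_map_poly)
qed

lemma poly_cpoly_cnj: "poly (cpoly p) (cnj z) = cnj (poly (cpoly p) z)"
  by (simp add: poly_cpoly_sum[OF order_refl])

text \<open>The coefficients are real, so nonreal zeros come in conjugate pairs.\<close>

lemma real_rooted_iff_upper_half_plane:
  assumes "p \<noteq> 0"
  shows "real_rooted p \<longleftrightarrow> (\<forall>z. 0 < Im z \<longrightarrow> poly (cpoly p) z \<noteq> 0)"
proof
  assume "real_rooted p"
  then show "\<forall>z. 0 < Im z \<longrightarrow> poly (cpoly p) z \<noteq> 0"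
    using assms by (auto simp: real_rooted_def complex_is_Real_iff)
next
  assume upper: "\<forall>z. 0 < Im z \<longrightarrow> poly (cpoly p) z \<noteq> 0"
  have "Im z = 0" if "poly (cpoly p) z = 0" for z
    using upper[rule_format, of z] upper[rule_format, of "cnj z"] that
    by (force simp: poly_cpoly_cnj)
  then show "real_rooted p"
    by (auto simp: real_rooted_def complex_is_Real_iff)
qed

lemma real_rooted_mult_iff:
  assumes "p \<noteq> 0" "q \<noteq> 0"
  shows "real_rooted (p * q) \<longleftrightarrow> real_rooted p \<and> real_rooted q"
  using assms by (auto simp: real_rooted_def cpoly_mult)

lemma real_rooted_smult: "real_rooted p \<Longrightarrow> real_rooted (smult c p)"
  by (auto simp: real_rooted_def cpoly_smult)

lemma real_rooted_smult_iff: "c \<noteq> 0 \<Longrightarrow> real_rooted (smult c p) \<longleftrightarrow> real_rooted p"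
  by (auto simp: real_rooted_def cpoly_smult)

lemma real_rooted_0 [simp]: "real_rooted 0"
  by (simp add: real_rooted_def)

lemma real_rooted_mult: "real_rooted p \<Longrightarrow> real_rooted q \<Longrightarrow> real_rooted (p * q)"
  by (cases "p = 0"; cases "q = 0") (auto simp: real_rooted_mult_iff)

lemma real_rooted_const [simp]: "real_rooted [:c:]"
  by (auto simp: real_rooted_def map_poly_pCons)

lemma real_rooted_1 [simp]: "real_rooted 1"
  by (simp flip: one_pCons add: real_rooted_const[of 1, unfolded one_pCons[symmetric]])

lemma real_rooted_linear [simp]: "real_rooted [:a, b:]"
proof (cases "b = 0")
  case False
  have "z = complex_of_real (- a / b)" if "complex_of_real a + z * complex_of_real b = 0" for z
    using that False by (simp add: field_simps eq_neg_iff_add_eq_0)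
  with False show ?thesis
    by (fastforce simp: real_rooted_def map_poly_pCons)
qed auto

lemma real_rooted_power: "real_rooted p \<Longrightarrow> real_rooted (p ^ k)"
  by (induction k) (auto intro: real_rooted_mult)

lemma real_rooted_monom [simp]: "real_rooted (monom c k)"
  by (simp add: monom_altdef real_rooted_smult real_rooted_power)

lemma real_rooted_monom_mult_iff:
  "real_rooted (monom 1 k * p) \<longleftrightarrow> real_rooted p"
  by (cases "p = 0") (simp_all add: real_rooted_mult_iff)

lemma real_rooted_factorization:
  assumes "real_rooted p"
  obtains xs where "length xs = degree p" "p = smult (lead_coeff p) (\<Prod>x\<leftarrow>xs. [:- x, 1:])"
proof -
  have "\<exists>xs. length xs = degree p \<and> p = smult (lead_coeff p) (\<Prod>x\<leftarrow>xs. [:- x, 1:])"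
    using assms
  proof (induction "degree p" arbitrary: p)
    case 0
    then show ?case
      by (intro exI[of _ "[]"]) (auto elim: degree_eq_zeroE)
  next
    case (Suc k)
    then obtain z where z: "poly (cpoly p) z = 0"
      using alg_closed_imp_poly_has_root[of "cpoly p"] by auto
    from Suc have "p \<noteq> 0" by auto
    with Suc.prems z obtain x where x: "z = complex_of_real x"
      by (auto simp: real_rooted_def elim: Reals_cases)
    with z have "poly p x = 0" by simp
    then obtain r where r: "p = [:- x, 1:] * r"
      by (auto simp: poly_eq_0_iff_dvd elim: dvdE)
    with \<open>p \<noteq> 0\<close> have "r \<noteq> 0" by auto
    with r have "real_rooted r"
      using Suc.prems by (simp add: real_rooted_mult_iff del: mult_pCons_left)
    moreover have deg: "degree p = Suc (degree r)"
      using r \<open>r \<noteq> 0\<close> by (simp add: degree_mult_eq del: mult_pCons_left)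
    moreover have "lead_coeff p = lead_coeff r"
      using r by (simp add: lead_coeff_mult del: mult_pCons_left)
    ultimately obtain xs where xs: "length xs = degree r" "r = smult (lead_coeff p) (\<Prod>x\<leftarrow>xs. [:- x, 1:])"
      using Suc.hyps(1)[of r] Suc.hyps(2) by (metis Suc_inject)
    have "smult (lead_coeff p) (\<Prod>x\<leftarrow>x # xs. [:- x, 1:]) =
        [:- x, 1:] * smult (lead_coeff p) (\<Prod>x\<leftarrow>xs. [:- x, 1:])"
      by (simp only: list.map prod_list.Cons mult_smult_right)
    then have "p = smult (lead_coeff p) (\<Prod>x\<leftarrow>x # xs. [:- x, 1:])"
      using r xs(2) by metis
    with xs(1) deg show ?case
      by (intro exI[of _ "x # xs"]) simp
  qed
  then show ?thesis using that by blast
qed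

text \<open>Cauchy--Schwarz against the all-ones vector, used for means of points of a disc and
  again for reciprocals of roots.\<close>

lemma sum_list_power2_le:
  fixes xs :: "real list"
  shows "(sum_list xs)\<^sup>2 \<le> real (length xs) * (\<Sum>x\<leftarrow>xs. x\<^sup>2)"
proof (induction xs)
  case (Cons x xs)
  define l S Q where "l = real (length xs)" and "S = sum_list xs" and "Q = (\<Sum>x\<leftarrow>xs. x\<^sup>2)"
  have IH: "S\<^sup>2 \<le> l * Q" using Cons by (simp add: l_def S_def Q_def)
  have Q: "0 \<le> Q" unfolding Q_def by (intro sum_list_nonneg) auto
  have "2 * x * S \<le> l * x\<^sup>2 + Q"
  proof (cases "l = 0")
    case True
    with Q IH show ?thesis by simp
  next
    case False
    then have l: "0 < l" by (simp add: l_def)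
    have "0 \<le> (l * x - S)\<^sup>2" by simp
    then have "2 * (l * x * S) \<le> l\<^sup>2 * x\<^sup>2 + S\<^sup>2"
      by (simp add: power2_diff power_mult_distrib algebra_simps)
    also have "\<dots> \<le> l\<^sup>2 * x\<^sup>2 + l * Q" using IH by simp
    finally have "l * (2 * x * S) \<le> l * (l * x\<^sup>2 + Q)"
      by (simp add: algebra_simps power2_eq_square)
    with l show ?thesis by simp
  qed
  with IH have "(x + S)\<^sup>2 \<le> (1 + l) * (x\<^sup>2 + Q)"
    by (simp add: power2_sum algebra_simps)
  then show ?case by (simp add: l_def S_def Q_def)
qed auto

section \<open>Laguerre's theorem on polar derivatives\<close>

lemma poly_pderiv_prod_linear:
  fixes t :: complex
  assumes "t \<notin> set rs"
  shows "poly (pderiv (\<Prod>r\<leftarrow>rs. [:- r, 1:])) t =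
    poly (\<Prod>r\<leftarrow>rs. [:- r, 1:]) t * (\<Sum>r\<leftarrow>rs. 1 / (t - r))"
  using assms
  by (induction rs)
    (auto simp: pderiv_mult pderiv_pCons divide_simps algebra_simps simp del: mult_pCons_left)

text \<open>For \<open>Im t > 0\<close> the map \<open>r \<mapsto> 1 / (t - r)\<close> sends the closed lower half plane into the disc
  \<open>|w|\<^sup>2 Im t + Im w \<le> 0\<close>, which contains the means of its points; a missing root is the point
  \<open>0\<close> of the disc.\<close>

lemma Laguerre_disc:
  assumes "Im r \<le> 0" "0 < Im t"
  shows "(cmod (1 / (t - r)))\<^sup>2 * Im t + Im (1 / (t - r)) \<le> 0"
proof -
  have "(cmod (1 / (t - r)))\<^sup>2 * Im t + Im (1 / (t - r)) = Im r / (cmod (t - r))\<^sup>2"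
    by (simp add: Im_divide norm_divide power_divide cmod_power2 diff_divide_distrib flip: add_divide_distrib)
  also have "\<dots> \<le> 0" using assms by (simp add: divide_nonpos_nonneg)
  finally show ?thesis .
qed

text \<open>This is m^2 times the disc inequality for the mean \<open>sum_list ws / m\<close>,
  obtained from the triangle inequality and Cauchy--Schwarz. A list shorter than \<open>m\<close>
  stands for one padded by the point 0.\<close>

lemma Laguerre_disc_mean:
  assumes "\<And>w. w \<in> set ws \<Longrightarrow> (cmod w)\<^sup>2 * y + Im w \<le> 0" "0 \<le> y" "length ws \<le> m"
  shows "(cmod (sum_list ws))\<^sup>2 * y + real m * Im (sum_list ws) \<le> 0"
proof -
  have sums: "(\<Sum>w\<leftarrow>ws. (cmod w)\<^sup>2) * y + Im (sum_list ws) \<le> 0"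
    using assms(1)
  proof (induction ws)
    case (Cons w ws)
    from Cons.prems[of w] Cons.IH Cons.prems show ?case
      by (simp add: distrib_right) (smt (verit, best))
  qed auto
  have nonneg: "0 \<le> (\<Sum>w\<leftarrow>ws. (cmod w)\<^sup>2)" by (intro sum_list_nonneg) auto
  have "cmod (sum_list ws) \<le> (\<Sum>w\<leftarrow>ws. cmod w)"
    by (induction ws) (auto intro: norm_triangle_le)
  then have "(cmod (sum_list ws))\<^sup>2 \<le> (\<Sum>w\<leftarrow>ws. cmod w)\<^sup>2"
    by (intro power_mono) auto
  also have "\<dots> \<le> real (length ws) * (\<Sum>w\<leftarrow>ws. (cmod w)\<^sup>2)"
    using sum_list_power2_le[of "map cmod ws"] by (simp add: o_def)
  also have "\<dots> \<le> real m * (\<Sum>w\<leftarrow>ws. (cmod w)\<^sup>2)"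
    using assms(3) nonneg by (intro mult_right_mono) auto
  finally have "(cmod (sum_list ws))\<^sup>2 * y \<le> real m * ((\<Sum>w\<leftarrow>ws. (cmod w)\<^sup>2) * y)"
    using assms(2) by (metis mult.assoc mult_right_mono)
  also have "\<dots> \<le> real m * (- Im (sum_list ws))"
    using sums by (intro mult_left_mono) auto
  finally show ?thesis by simp
qed

text \<open>By the logarithmic derivative, a vanishing polar derivative says that the mean of the
  numbers \<open>1 / (t - r)\<close>, padded by zeros to \<open>m\<close> entries, is
  \<open>1 / (t - \<zeta>)\<close>. That point lies outside the disc, since its disc expression is
  \<open>Im \<zeta> / (cmod (t - \<zeta>))\<^sup>2 > 0\<close>.\<close>

lemma Laguerre_polar_derivative:
  fixes p :: "complex poly"
  assumes "degree p \<le> m" "0 < m" and p: "\<And>z. 0 < Im z \<Longrightarrow> poly p z \<noteq> 0"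
    and t: "0 < Im t" and \<zeta>: "0 < Im \<zeta>"
  shows "of_nat m * poly p t + (\<zeta> - t) * poly (pderiv p) t \<noteq> 0"
proof
  assume eq: "of_nat m * poly p t + (\<zeta> - t) * poly (pderiv p) t = 0"
  have "p \<noteq> 0" using p[OF t] by auto
  obtain A where A: "size A = degree p" "p = smult (lead_coeff p) (\<Prod>x\<in>#A. [:-x, 1:])"
    using alg_closed_imp_factorization[OF \<open>p \<noteq> 0\<close>] by metis
  obtain rs where rs: "mset rs = A" using ex_mset by blast
  have len: "length rs = degree p" using A(1) rs by auto
  have fac: "p = smult (lead_coeff p) (\<Prod>r\<leftarrow>rs. [:-r, 1:])"
    using A(2) rs by (metis mset_map prod_mset_prod_list)
  define ws where "ws = map (\<lambda>r. 1 / (t - r)) rs"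
  have root: "Im r \<le> 0" if "r \<in> set rs" for r
  proof -
    have "poly (\<Prod>r\<leftarrow>rs. [:-r, 1:]) r = 0"
      using that by (induction rs) auto
    then have "poly p r = 0" by (subst fac) simp
    with p[of r] show ?thesis by force
  qed
  with t have "t \<notin> set rs" by force
  then have "poly (pderiv p) t = poly p t * sum_list ws"
    by (subst fac, subst (3) fac) (simp add: pderiv_smult poly_pderiv_prod_linear ws_def)
  with eq have "poly p t * (of_nat m + (\<zeta> - t) * sum_list ws) = 0"
    by (simp add: algebra_simps)
  with p[OF t] have *: "of_nat m + (\<zeta> - t) * sum_list ws = 0" by simp
  with \<open>0 < m\<close> have "\<zeta> \<noteq> t" by auto
  with * have W: "sum_list ws = of_nat m * (1 / (t - \<zeta>))"
    by (simp add: field_simps)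
  have "(cmod (sum_list ws))\<^sup>2 * Im t + real m * Im (sum_list ws) \<le> 0"
    using root t len assms(1) by (intro Laguerre_disc_mean) (auto simp: ws_def intro!: Laguerre_disc)
  moreover have "(cmod (sum_list ws))\<^sup>2 * Im t + real m * Im (sum_list ws) = (real m)\<^sup>2 * (Im \<zeta> / (cmod (t - \<zeta>))\<^sup>2)"
    unfolding W
    by (simp add: norm_mult norm_divide power_mult_distrib power_divide Im_divide cmod_power2
        power2_eq_square[of "real m"] algebra_simps diff_divide_distrib flip: add_divide_distrib)
  moreover have "0 < (real m)\<^sup>2 * (Im \<zeta> / (cmod (t - \<zeta>))\<^sup>2)"
    using \<open>0 < m\<close> \<zeta> \<open>\<zeta> \<noteq> t\<close> by (intro mult_pos_pos divide_pos_pos) auto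
  ultimately show False by simp
qed

section \<open>Coincidence of polar forms\<close>

lemma degree_prod_list_linear_le: "degree (\<Prod>x\<leftarrow>xs. [:a x, b x:]) \<le> length xs"
proof (induction xs)
  case (Cons x xs)
  have "degree ([:a x, b x:] * (\<Prod>x\<leftarrow>xs. [:a x, b x:])) \<le> 1 + degree (\<Prod>x\<leftarrow>xs. [:a x, b x:])"
    using degree_mult_le[of "[:a x, b x:]" "\<Prod>x\<leftarrow>xs. [:a x, b x:]"] by (auto split: if_splits)
  with Cons show ?case by simp
qed auto

lemma coeff_linear_mult:
  fixes a b :: "'a::comm_semiring_0"
  shows "coeff ([:a, b:] * P) k = a * coeff P k + (case k of 0 \<Rightarrow> 0 | Suc j \<Rightarrow> b * coeff P j)"
  by (simp add: coeff_pCons split: nat.splits)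

text \<open>Coefficient k of the product is the elementary symmetric function e_k of
  \<open>xs\<close>, so the sum is the polar form of \<open>p\<close> at \<open>xs\<close>.
  Induction fixes one argument at a time: this replaces \<open>p\<close> by a polar derivative of
  smaller formal degree, which by Laguerre again has no zeros in the upper half plane.\<close>

theorem Grace_Walsh_Szego:
  fixes p :: "complex poly"
  assumes "degree p \<le> length xs" "\<And>z. 0 < Im z \<Longrightarrow> poly p z \<noteq> 0" "\<And>x. x \<in> set xs \<Longrightarrow> 0 < Im x"
  shows "(\<Sum>k\<le>length xs. coeff p k * coeff (\<Prod>x\<leftarrow>xs. [:1, x:]) k / of_nat (length xs choose k)) \<noteq> 0"
  using assms
proof (induction xs arbitrary: p)
  case Nil
  then have "poly p \<i> \<noteq> 0" "degree p = 0" by auto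
  then show ?case by (auto simp: poly_altdef)
next
  case (Cons x xs)
  define m where "m = length xs"
  define E where "E = (\<Prod>x\<leftarrow>xs. [:1, x:])"
  \<comment> \<open>The polar derivative with respect to \<open>x\<close> for formal degree
    \<open>Suc m\<close>; its coefficient at \<open>Suc m\<close> cancels.\<close>
  define q where "q = smult (of_nat (Suc m)) p + [:x, -1:] * pderiv p"
  have coeff_q: "coeff q k = (of_nat (Suc m) - of_nat k) * coeff p k + of_nat (Suc k) * x * coeff p (Suc k)" for k
    by (cases k) (simp_all add: q_def coeff_linear_mult coeff_pderiv algebra_simps)
  have "degree q \<le> m"
  proof (rule degree_le, intro allI impI)
    fix k assume "m < k"
    then consider "k = Suc m" | "degree p < k" using Cons.prems(1) by (force simp: m_def)
    then show "coeff q k = 0"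
      by cases (use Cons.prems(1) in \<open>auto simp: coeff_q m_def coeff_eq_0\<close>)
  qed
  moreover have "poly q t \<noteq> 0" if "0 < Im t" for t
    using Laguerre_polar_derivative[of p "Suc m" t x] Cons.prems that
    by (simp add: q_def m_def algebra_simps)
  ultimately have nz: "(\<Sum>k\<le>m. coeff q k * coeff E k / of_nat (m choose k)) \<noteq> 0"
    using Cons.IH[of q] Cons.prems(3) by (simp add: m_def E_def)
  have E: "coeff E (Suc m) = 0"
    using degree_prod_list_linear_le[of "\<lambda>_. 1" "\<lambda>x. x" xs] by (intro coeff_eq_0) (simp add: E_def m_def)
  \<comment> \<open>Passing from formal degree \<open>m\<close> to \<open>Suc m\<close> in the
    binomial denominators produces exactly the two factors in \<open>coeff_q\<close>, up to the
    constant \<open>Suc m\<close>.\<close>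
  have b1: "(of_nat (Suc m) - of_nat k) / of_nat (m choose k) = (of_nat (Suc m) / of_nat (Suc m choose k) :: complex)"
    if "k \<le> m" for k
  proof -
    have "(Suc m - k) * (Suc m choose k) = Suc m * (m choose k)"
      using binomial_absorb_comp[of "Suc m" k] by simp
    then have "of_nat (Suc m - k) * of_nat (Suc m choose k) = (of_nat (Suc m) * of_nat (m choose k) :: complex)"
      by (metis of_nat_mult)
    with that show ?thesis
      by (simp add: divide_simps of_nat_diff)
  qed
  have b2: "of_nat (Suc k) / of_nat (m choose k) = (of_nat (Suc m) / of_nat (Suc m choose Suc k) :: complex)"
    if "k \<le> m" for k
  proof -
    have "of_nat (Suc k) * of_nat (Suc m choose Suc k) = (of_nat (Suc m) * of_nat (m choose k) :: complex)"
      by (metis of_nat_mult Suc_times_binomial)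
    with that show ?thesis
      by (simp add: divide_simps del: binomial_Suc_Suc)
  qed
  let ?S = "\<Sum>k\<le>Suc m. coeff p k * coeff ([:1, x:] * E) k / of_nat (Suc m choose k)"
  have "?S = (\<Sum>k\<le>Suc m. coeff p k * coeff E k / of_nat (Suc m choose k)) +
      (\<Sum>k\<le>Suc m. coeff p k * (case k of 0 \<Rightarrow> 0 | Suc j \<Rightarrow> x * coeff E j) / of_nat (Suc m choose k))"
    by (simp add: coeff_linear_mult distrib_left add_divide_distrib sum.distrib
        del: mult_pCons_left sum.atMost_Suc)
  also have "(\<Sum>k\<le>Suc m. coeff p k * coeff E k / of_nat (Suc m choose k)) =
      (\<Sum>k\<le>m. coeff p k * coeff E k / of_nat (Suc m choose k))"
    by (simp add: E)
  also have "(\<Sum>k\<le>Suc m. coeff p k * (case k of 0 \<Rightarrow> 0 | Suc j \<Rightarrow> x * coeff E j) / of_nat (Suc m choose k)) =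
      (\<Sum>k\<le>m. coeff p (Suc k) * (x * coeff E k) / of_nat (Suc m choose Suc k))"
    by (subst sum.atMost_Suc_shift) (simp del: binomial_Suc_Suc)
  finally have "of_nat (Suc m) * ?S =
      (\<Sum>k\<le>m. coeff p k * coeff E k * (of_nat (Suc m) / of_nat (Suc m choose k)) +
        coeff p (Suc k) * x * coeff E k * (of_nat (Suc m) / of_nat (Suc m choose Suc k)))"
    by (simp add: distrib_left sum_distrib_left sum.distrib mult_ac del: binomial_Suc_Suc of_nat_Suc)
  also have "\<dots> = (\<Sum>k\<le>m. coeff q k * coeff E k / of_nat (m choose k))"
    by (intro sum.cong refl)
      (simp add: coeff_q algebra_simps flip: b1 b2 add_divide_distrib del: binomial_Suc_Suc of_nat_Suc)
  finally show ?case
    using nz by (auto simp: m_def E_def)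
qed

section \<open>The Schur--Szego composition theorem\<close>

text \<open>For real x, every factor |z - x| depends only on Re z and |Im z|, and it grows with |Im
  z|.\<close>

lemma real_rooted_norm_mono:
  assumes "real_rooted p" "Re w = Re z" "\<bar>Im w\<bar> \<le> \<bar>Im z\<bar>"
  shows "cmod (poly (cpoly p) w) \<le> cmod (poly (cpoly p) z)"
proof -
  obtain xs where xs: "p = smult (lead_coeff p) (\<Prod>x\<leftarrow>xs. [:- x, 1:])"
    using real_rooted_factorization[OF assms(1)] by blast
  have *: "cmod (w - complex_of_real x) \<le> cmod (z - complex_of_real x)" for x
    using assms(2,3) by (simp add: cmod_def real_sqrt_le_iff power_mono_iff abs_le_square_iff)
  have **: "poly (cpoly [:- x, 1:]) u = u - complex_of_real x" for x u
    by (simp add: map_poly_pCons)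
  have "cmod (poly (cpoly (\<Prod>x\<leftarrow>xs. [:- x, 1:])) w) \<le> cmod (poly (cpoly (\<Prod>x\<leftarrow>xs. [:- x, 1:])) z)"
    by (induction xs)
      (auto simp: cpoly_mult norm_mult ** simp del: mult_pCons_left intro!: mult_mono *)
  then have "cmod (complex_of_real (lead_coeff p)) * cmod (poly (cpoly (\<Prod>x\<leftarrow>xs. [:- x, 1:])) w)
      \<le> cmod (complex_of_real (lead_coeff p)) * cmod (poly (cpoly (\<Prod>x\<leftarrow>xs. [:- x, 1:])) z)"
    by (rule mult_left_mono) auto
  then show ?thesis
    by (subst xs, subst (2) xs) (simp add: cpoly_smult norm_mult)
qed

text \<open>A nonreal zero \<open>z\<close> of the limit forces zeros on the whole vertical segment below \<open>z\<close>, since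
  \<open>|p|\<close> increases along vertical half-lines for real-rooted \<open>p\<close>; so degrees may drop in the limit.\<close>

lemma real_rooted_limit:
  assumes "\<And>i. real_rooted (f i)" "\<And>i. degree (f i) \<le> n" "degree p \<le> n"
    and lim: "\<And>k. k \<le> n \<Longrightarrow> (\<lambda>i. coeff (f i) k) \<longlonglongrightarrow> coeff p k"
  shows "real_rooted p"
proof (cases "p = 0")
  case False
  have lim': "(\<lambda>i. poly (cpoly (f i)) z) \<longlonglongrightarrow> poly (cpoly p) z" for z
    unfolding poly_cpoly_sum[OF assms(2)] poly_cpoly_sum[OF assms(3)]
    by (intro tendsto_intros lim) auto
  have "poly (cpoly p) z \<noteq> 0" if z: "0 < Im z" for z
  proof
    assume zero: "poly (cpoly p) z = 0"
    have "poly (cpoly p) (Complex (Re z) y) = 0" if y: "y \<in> {0..Im z}" for y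
    proof -
      have "cmod (poly (cpoly p) (Complex (Re z) y)) \<le> cmod (poly (cpoly p) z)"
        using y by (intro LIMSEQ_le[OF tendsto_norm[OF lim'] tendsto_norm[OF lim']] exI[of _ 0]
            allI impI real_rooted_norm_mono assms(1)) auto
      with zero show ?thesis by simp
    qed
    then have "Complex (Re z) ` {0..Im z} \<subseteq> {w. poly (cpoly p) w = 0}" by auto
    moreover have "finite {w. poly (cpoly p) w = 0}"
      using False by (intro poly_roots_finite) simp
    ultimately have "finite (Complex (Re z) ` {0..Im z})" by (rule finite_subset)
    then have "finite {0..Im z}"
      by (rule finite_imageD) (auto simp: inj_on_def)
    with z show False by (simp add: infinite_Icc)
  qed
  with False show ?thesis by (simp add: real_rooted_iff_upper_half_plane)
qed auto

definition scale_coeffs :: "(nat \<Rightarrow> real) \<Rightarrow> real poly \<Rightarrow> real poly" where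
  "scale_coeffs \<gamma> p = (\<Sum>k\<le>degree p. monom (\<gamma> k * coeff p k) k)"

lemma coeff_scale_coeffs [simp]: "coeff (scale_coeffs \<gamma> p) k = \<gamma> k * coeff p k"
  by (auto simp: scale_coeffs_def coeff_sum coeff_eq_0)

lemma degree_scale_coeffs_le: "degree (scale_coeffs \<gamma> p) \<le> degree p"
  by (rule degree_le) (auto simp: coeff_eq_0)

text \<open>Homogeneity of the elementary symmetric functions.\<close>

lemma coeff_prod_list_scale:
  fixes c :: "'a::comm_ring_1"
  shows "coeff (\<Prod>x\<leftarrow>xs. [:1, c * f x:]) k = c ^ k * coeff (\<Prod>x\<leftarrow>xs. [:1, f x:]) k"
proof (induction xs arbitrary: k)
  case Nil
  then show ?case by (cases k) auto
next
  case (Cons x xs)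
  then show ?case
    by (cases k) (simp_all add: coeff_linear_mult algebra_simps del: mult_pCons_left)
qed

lemma cpoly_prod_list: "cpoly (prod_list ps) = (\<Prod>p\<leftarrow>ps. cpoly p)"
  by (induction ps) (auto simp: cpoly_mult)

text \<open>With y = b / a for each factor, coefficient k of \<open>G\<close> is a fixed nonzero
  multiple of e_k(ys) unless \<open>c = 0\<close>. Hence the scaled polynomial at z is a nonzero
  multiple of the polar form of \<open>p\<close> at the points z y, which stay in the upper half
  plane because y > 0. Writing factors as pairs allows b to tend to 0, that is, a root to tend to
  infinity.\<close>

lemma Schur_Szego_pos:
  assumes p: "real_rooted p" "degree p \<le> n"
    and G: "G = smult c (\<Prod>(a, b)\<leftarrow>ps. [:a, b:])" "length ps = n"
    and pos: "\<And>a b. (a, b) \<in> set ps \<Longrightarrow> 0 < a \<and> 0 < b"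
    and \<gamma>: "\<And>k. k \<le> n \<Longrightarrow> coeff G k = real (n choose k) * \<gamma> k"
  shows "real_rooted (scale_coeffs \<gamma> p)"
proof (cases "p = 0 \<or> c = 0")
  case True
  have "scale_coeffs \<gamma> p = 0"
  proof (rule poly_eqI)
    fix k show "coeff (scale_coeffs \<gamma> p) k = coeff 0 k"
      using True \<gamma>[of k] p(2) by (cases "k \<le> n") (auto simp: G(1) coeff_eq_0)
  qed
  then show ?thesis by simp
next
  case False
  define ys where "ys = map (\<lambda>(a, b). b / a) ps"
  define A where "A = c * (\<Prod>(a, b)\<leftarrow>ps. a)"
  have "A \<noteq> 0"
    using False pos by (auto simp: A_def prod_list_zero_iff)
  have "(\<Prod>(a, b)\<leftarrow>ps. [:a, b:]) = smult (\<Prod>(a, b)\<leftarrow>ps. a) (\<Prod>y\<leftarrow>ys. [:1, y:])"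
    using pos unfolding ys_def
  proof (induction ps)
    case (Cons ab ps)
    obtain a b where ab: "ab = (a, b)" by force
    with Cons.prems have "[:a, b:] = smult a [:1, b / a:]" by force
    moreover have "(\<Prod>(a, b)\<leftarrow>ps. [:a, b:]) =
        smult (\<Prod>(a, b)\<leftarrow>ps. a) (\<Prod>y\<leftarrow>map (\<lambda>(a, b). b / a) ps. [:1, y:])"
      using Cons by (metis list.set_intros(2))
    ultimately show ?case
      unfolding ab list.map prod_list.Cons case_prod_conv
      by (simp only: mult_smult_left mult_smult_right smult_smult mult.commute)
  qed auto
  with G have G': "G = smult A (\<Prod>y\<leftarrow>ys. [:1, y:])" by (simp add: A_def)
  have len: "length ys = n" using G by (simp add: ys_def)
  have ypos: "0 < y" if "y \<in> set ys" for y using that pos by (auto simp: ys_def)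
  have eval: "poly (cpoly (scale_coeffs \<gamma> p)) z \<noteq> 0" if z: "0 < Im z" for z
  proof -
    define xs where "xs = map (\<lambda>y. z * complex_of_real y) ys"
    have E: "coeff (\<Prod>x\<leftarrow>xs. [:1, x:]) k = z ^ k * complex_of_real (coeff (\<Prod>y\<leftarrow>ys. [:1, y:]) k)" for k
    proof -
      have "cpoly (\<Prod>y\<leftarrow>ys. [:1, y:]) = (\<Prod>y\<leftarrow>ys. [:1, complex_of_real y:])"
        by (simp add: cpoly_prod_list map_poly_pCons o_def)
      then have "complex_of_real (coeff (\<Prod>y\<leftarrow>ys. [:1, y:]) k) = coeff (\<Prod>y\<leftarrow>ys. [:1, complex_of_real y:]) k"
        by (metis coeff_map_poly of_real_0)
      then show ?thesis
        by (simp add: xs_def o_def coeff_prod_list_scale)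
    qed
    have "complex_of_real A * (\<Sum>k\<le>n. coeff (cpoly p) k * coeff (\<Prod>x\<leftarrow>xs. [:1, x:]) k / of_nat (n choose k)) =
        (\<Sum>k\<le>n. complex_of_real (\<gamma> k * coeff p k) * z ^ k)"
      unfolding sum_distrib_left
    proof (intro sum.cong refl)
      fix k assume "k \<in> {..n}"
      then have "k \<le> n" by simp
      then have "\<gamma> k = A * coeff (\<Prod>y\<leftarrow>ys. [:1, y:]) k / real (n choose k)"
        using \<gamma>[of k] by (simp add: G' field_simps)
      then show "complex_of_real A * (coeff (cpoly p) k * coeff (\<Prod>x\<leftarrow>xs. [:1, x:]) k / of_nat (n choose k)) =
          complex_of_real (\<gamma> k * coeff p k) * z ^ k"
        by (simp add: E coeff_map_poly)
    qed
    also have "\<dots> = poly (cpoly (scale_coeffs \<gamma> p)) z"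
      using degree_scale_coeffs_le[of \<gamma> p] p(2) by (simp add: poly_cpoly_sum[of _ n])
    finally have eq: "complex_of_real A * (\<Sum>k\<le>n. coeff (cpoly p) k * coeff (\<Prod>x\<leftarrow>xs. [:1, x:]) k / of_nat (n choose k)) =
        poly (cpoly (scale_coeffs \<gamma> p)) z" .
    have "(\<Sum>k\<le>length xs. coeff (cpoly p) k * coeff (\<Prod>x\<leftarrow>xs. [:1, x:]) k / of_nat (length xs choose k)) \<noteq> 0"
    proof (rule Grace_Walsh_Szego)
      show "degree (cpoly p) \<le> length xs" using p(2) len by (simp add: xs_def)
      show "poly (cpoly p) w \<noteq> 0" if "0 < Im w" for w
        using that p(1) False by (simp add: real_rooted_iff_upper_half_plane)
      show "0 < Im x" if "x \<in> set xs" for x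
        using that ypos z by (auto simp: xs_def)
    qed
    with \<open>A \<noteq> 0\<close> eq show ?thesis by (auto simp: xs_def len)
  qed
  then show ?thesis
    by (cases "scale_coeffs \<gamma> p = 0") (simp_all add: real_rooted_iff_upper_half_plane)
qed

text \<open>Unlike \<open>real_rooted\<close>, this excludes the zero polynomial, of which every
  complex number is a root.\<close>

definition nonpos_rooted :: "real poly \<Rightarrow> bool" where
  "nonpos_rooted p \<longleftrightarrow> (\<forall>z. poly (cpoly p) z = 0 \<longrightarrow> z \<in> \<real> \<and> Re z \<le> 0)"

text \<open>Adding \<open>\<epsilon> i > 0\<close> to both coefficients of every factor a + b t
  makes them positive, so \<open>Schur_Szego_pos\<close> applies; \<open>real_rooted_limit\<close>
  then removes the perturbation.\<close>

theorem Schur_Szego: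
  assumes p: "real_rooted p" "degree p \<le> n"
    and G: "nonpos_rooted G" "degree G \<le> n"
    and \<gamma>: "\<And>k. k \<le> n \<Longrightarrow> coeff G k = real (n choose k) * \<gamma> k"
  shows "real_rooted (scale_coeffs \<gamma> p)"
proof -
  have "real_rooted G" using G(1) by (auto simp: nonpos_rooted_def real_rooted_def)
  then obtain xs where len: "length xs = degree G" and
    xs: "G = smult (lead_coeff G) (\<Prod>x\<leftarrow>xs. [:- x, 1:])"
    by (rule real_rooted_factorization)
  have xneg: "x \<le> 0" if "x \<in> set xs" for x
  proof -
    have "poly (\<Prod>x\<leftarrow>xs. [:- x, 1:]) x = 0" using that by (induction xs) auto
    then have "poly G x = 0" by (subst xs) simp
    then have "poly (cpoly G) (complex_of_real x) = 0" by simp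
    with G(1) show ?thesis unfolding nonpos_rooted_def by fastforce
  qed
  \<comment> \<open>The constant factors \<open>(1, 0)\<close> stand for roots at infinity when
    \<open>degree G < n\<close>.\<close>
  define ps :: "(real \<times> real) list" where "ps = map (\<lambda>x. (- x, 1)) xs @ replicate (n - degree G) (1, 0)"
  define c where "c = lead_coeff G"
  have ps: "G = smult c (\<Prod>(a, b)\<leftarrow>ps. [:a, b:])"
    by (subst xs) (simp add: ps_def c_def o_def flip: one_pCons)
  have psn: "length ps = n" using len G(2) by (simp add: ps_def)
  have nonneg: "0 \<le> a \<and> 0 \<le> b" if "(a, b) \<in> set ps" for a b
    using that xneg by (auto simp: ps_def)
  define \<epsilon> where "\<epsilon> i = inverse (real (Suc i))" for i
  have \<epsilon>: "\<epsilon> \<longlonglongrightarrow> 0" unfolding \<epsilon>_def by (rule LIMSEQ_inverse_real_of_nat)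
  define ps' where "ps' i = map (\<lambda>(a, b). (a + \<epsilon> i, b + \<epsilon> i)) ps" for i
  define H where "H i = smult c (\<Prod>(a, b)\<leftarrow>ps' i. [:a, b:])" for i
  have "(\<lambda>i. coeff (\<Prod>(a, b)\<leftarrow>ps' i. [:a, b:]) k) \<longlonglongrightarrow> coeff (\<Prod>(a, b)\<leftarrow>ps. [:a, b:]) k" for k
    unfolding ps'_def
  proof (induction ps arbitrary: k)
    case (Cons ab ps)
    obtain a b where ab: "ab = (a, b)" by force
    have "(\<lambda>i. a + \<epsilon> i) \<longlonglongrightarrow> a" "(\<lambda>i. b + \<epsilon> i) \<longlonglongrightarrow> b"
      using tendsto_add[OF tendsto_const[of a] \<epsilon>] tendsto_add[OF tendsto_const[of b] \<epsilon>] by simp_all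
    then show ?case
      using Cons
      by (cases k) (auto simp: ab coeff_linear_mult simp del: mult_pCons_left intro!: tendsto_intros)
  qed auto
  then have lim: "(\<lambda>i. coeff (H i) k) \<longlonglongrightarrow> coeff G k" for k
    by (subst ps) (auto simp: H_def intro!: tendsto_intros)
  define \<delta> where "\<delta> i k = coeff (H i) k / real (n choose k)" for i k
  show ?thesis
  proof (rule real_rooted_limit)
    show "degree (scale_coeffs \<gamma> p) \<le> n" "degree (scale_coeffs (\<delta> i) p) \<le> n" for i
      using degree_scale_coeffs_le p(2) order_trans by blast+
    show "real_rooted (scale_coeffs (\<delta> i) p)" for i
    proof (rule Schur_Szego_pos[OF p H_def])
      show "length (ps' i) = n" by (simp add: ps'_def psn)
      have "0 < \<epsilon> i" by (simp add: \<epsilon>_def)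
      then show "0 < a \<and> 0 < b" if "(a, b) \<in> set (ps' i)" for a b
        using that nonneg by (fastforce simp: ps'_def)
    qed (auto simp: \<delta>_def)
    show "(\<lambda>i. coeff (scale_coeffs (\<delta> i) p) k) \<longlonglongrightarrow> coeff (scale_coeffs \<gamma> p) k" if "k \<le> n" for k
    proof -
      have "\<gamma> k = coeff G k / real (n choose k)" using \<gamma>[OF that] that by simp
      then show ?thesis
        using that by (auto simp: \<delta>_def intro!: tendsto_intros lim)
    qed
  qed
qed

section \<open>Reflection at the origin and differentiation\<close>

lemma coeff_reflect: "coeff (p \<circ>\<^sub>p [:0, -1:]) k = (-1) ^ k * coeff (p :: real poly) k"
  using coeff_pcompose_linear[of p "-1" k] by simp

lemma poly_cpoly_reflect: "poly (cpoly (p \<circ>\<^sub>p [:0, -1:])) z = poly (cpoly p) (- z)"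
proof -
  have "degree (p \<circ>\<^sub>p [:0, -1:]) \<le> degree p"
    by (rule degree_le) (simp add: coeff_reflect coeff_eq_0)
  then show ?thesis
    by (simp add: poly_cpoly_sum[of _ "degree p"] coeff_reflect power_minus[of z] mult_ac)
qed

lemma real_rooted_reflect_iff: "real_rooted (p \<circ>\<^sub>p [:0, -1:]) \<longleftrightarrow> real_rooted p"
proof -
  have "p \<circ>\<^sub>p [:0, -1:] = 0 \<longleftrightarrow> p = 0"
    by (simp add: poly_eq_iff coeff_reflect)
  moreover have "(\<forall>z. poly (cpoly p) (- z) = 0 \<longrightarrow> z \<in> \<real>) \<longleftrightarrow> (\<forall>z. poly (cpoly p) z = 0 \<longrightarrow> z \<in> \<real>)"
    by (metis minus_minus Reals_minus)
  ultimately show ?thesis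
    by (simp add: real_rooted_def poly_cpoly_reflect)
qed

definition nonneg_rooted :: "real poly \<Rightarrow> bool" where
  "nonneg_rooted p \<longleftrightarrow> (\<forall>z. poly (cpoly p) z = 0 \<longrightarrow> z \<in> \<real> \<and> 0 \<le> Re z)"

lemma nonpos_rooted_reflect_iff: "nonpos_rooted (p \<circ>\<^sub>p [:0, -1:]) \<longleftrightarrow> nonneg_rooted p"
  unfolding nonpos_rooted_def nonneg_rooted_def poly_cpoly_reflect
proof (intro iffI allI impI)
  fix z
  assume *: "\<forall>z. poly (cpoly p) (- z) = 0 \<longrightarrow> z \<in> \<real> \<and> Re z \<le> 0" and z: "poly (cpoly p) z = 0"
  from *[rule_format, of "- z"] z show "z \<in> \<real> \<and> 0 \<le> Re z" by simp
next
  fix z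
  assume *: "\<forall>z. poly (cpoly p) z = 0 \<longrightarrow> z \<in> \<real> \<and> 0 \<le> Re z" and z: "poly (cpoly p) (- z) = 0"
  from *[rule_format, of "- z"] z show "z \<in> \<real> \<and> Re z \<le> 0" by simp
qed

corollary Schur_Szego':
  assumes p: "real_rooted p" "degree p \<le> n"
    and G: "nonpos_rooted G \<or> nonneg_rooted G" "degree G \<le> n"
    and \<gamma>: "\<And>k. k \<le> n \<Longrightarrow> coeff G k = real (n choose k) * \<gamma> k"
  shows "real_rooted (scale_coeffs \<gamma> p)"
  using G(1)
proof
  assume "nonpos_rooted G"
  from Schur_Szego[OF p this G(2) \<gamma>] show ?thesis .
next
  assume "nonneg_rooted G"
  then have *: "nonpos_rooted (G \<circ>\<^sub>p [:0, -1:])" by (simp add: nonpos_rooted_reflect_iff)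
  have "real_rooted (scale_coeffs (\<lambda>k. (-1) ^ k * \<gamma> k) p)"
  proof (rule Schur_Szego[OF p *])
    show "degree (G \<circ>\<^sub>p [:0, -1:]) \<le> n"
      using G(2) by (intro degree_le) (simp add: coeff_reflect coeff_eq_0)
  qed (simp add: coeff_reflect \<gamma>)
  moreover have "scale_coeffs (\<lambda>k. (-1) ^ k * \<gamma> k) p = scale_coeffs \<gamma> p \<circ>\<^sub>p [:0, -1:]"
    by (rule poly_eqI) (simp add: coeff_reflect)
  ultimately show ?thesis by (simp add: real_rooted_reflect_iff)
qed

text \<open>With n the degree of \<open>p\<close>, the polynomial t p' arises from \<open>p\<close>
  by the weights k, and n t (1 + t)^(n-1), whose coefficients are k (n choose k), has only
  nonpositive roots.\<close>

lemma real_rooted_pderiv: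
  assumes "real_rooted p"
  shows "real_rooted (pderiv p)"
proof (cases "degree p")
  case 0
  then show ?thesis by (auto elim!: degree_eq_zeroE simp: pderiv_pCons)
next
  case (Suc m)
  define G where "G = monom (real (Suc m)) 1 * [:1, 1:] ^ m"
  have "real_rooted (scale_coeffs real p)"
  proof (rule Schur_Szego[OF assms order_refl])
    have "z \<in> \<real> \<and> Re z \<le> 0" if "z = 0 \<or> 1 + z = 0" for z :: complex
      using that by (auto simp: eq_neg_iff_add_eq_0[symmetric] add.commute[of 1])
    moreover have "poly (cpoly ([:1, 1:] ^ m)) z = (1 + z) ^ m" for z
      by (induction m) (auto simp: cpoly_mult map_poly_pCons simp del: mult_pCons_left)
    ultimately show "nonpos_rooted G"
      by (auto simp: nonpos_rooted_def G_def cpoly_mult map_poly_monom poly_monom simp del: of_nat_Suc)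
    show "degree G \<le> degree p"
      unfolding G_def by (rule order_trans[OF degree_mult_le])
        (simp add: degree_monom_eq degree_power_eq Suc del: of_nat_Suc)
    show "coeff G k = real (degree p choose k) * real k" for k
    proof (cases k)
      case (Suc j)
      have "real (Suc m) * real (m choose j) = real (Suc m choose Suc j) * real (Suc j)"
        using Suc_times_binomial[of j m] by (metis mult.commute of_nat_mult)
      moreover have "coeff ([:1, 1:] ^ m) j = real (m choose j)"
        using coeff_linear_poly_power[of j m 1 "1::real"]
        by (cases "j \<le> m") (simp_all add: coeff_eq_0 degree_power_eq)
      ultimately show ?thesis
        by (simp add: G_def Suc \<open>degree p = Suc m\<close> coeff_monom_mult del: of_nat_Suc binomial_Suc_Suc)
    qed (simp add: G_def coeff_monom_mult)
  qed
  also have "scale_coeffs real p = monom 1 1 * pderiv p"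
    by (rule poly_eqI) (auto simp: coeff_monom_mult coeff_pderiv)
  finally show ?thesis
    by (simp only: real_rooted_monom_mult_iff)
qed

section \<open>Extending quartics\<close>

lemma nonneg_rooted_prod_linear:
  assumes "\<And>x. x \<in> set xs \<Longrightarrow> 0 \<le> x" "c \<noteq> 0"
  shows "nonneg_rooted (smult c (\<Prod>x\<leftarrow>xs. [:- x, 1:]))"
proof -
  have "z \<in> complex_of_real ` set xs" if "poly (cpoly (\<Prod>x\<leftarrow>xs. [:- x, 1:])) z = 0" for z
    using that by (induction xs) (auto simp: cpoly_mult map_poly_pCons simp del: mult_pCons_left)
  with assms show ?thesis
    by (fastforce simp: nonneg_rooted_def cpoly_smult)
qed

lemma prod_list_map_sort:
  fixes f :: "'a::linorder \<Rightarrow> 'b::comm_monoid_mult"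
  shows "(\<Prod>x\<leftarrow>sort xs. f x) = (\<Prod>x\<leftarrow>xs. f x)"
  by (simp flip: prod_mset_prod_list)

lemma sorted_proots_factorization:
  assumes "real_rooted p" "p \<noteq> 0"
  obtains xs where "sorted xs" "mset xs = proots p" "length xs = degree p"
    "p = smult (lead_coeff p) (\<Prod>x\<leftarrow>xs. [:- x, 1:])"
proof -
  obtain ys where ys: "length ys = degree p" "p = smult (lead_coeff p) (\<Prod>x\<leftarrow>ys. [:- x, 1:])"
    using real_rooted_factorization[OF assms(1)] .
  have "proots (\<Prod>x\<leftarrow>ys. [:- x, 1:]) = mset ys"
  proof (induction ys)
    case (Cons y ys)
    have "(\<Prod>x\<leftarrow>ys. [:- x, 1:]) \<noteq> 0" by (auto simp: prod_list_zero_iff)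
    with Cons show ?case by (simp add: proots_mult del: mult_pCons_left)
  qed auto
  then have "proots p = mset ys"
    using assms(2) by (subst ys(2)) simp
  with ys show ?thesis
    by (intro that[of "sort ys"]) (auto simp: prod_list_map_sort)
qed

lemma degree_prod_monic_linear: "degree (\<Prod>x\<leftarrow>xs. [:- x :: real, 1:]) = length xs"
proof (induction xs)
  case (Cons x xs)
  have "(\<Prod>x\<leftarrow>xs. [:- x, 1:]) \<noteq> 0" by (auto simp: prod_list_zero_iff)
  with Cons show ?case by (simp add: degree_mult_eq del: mult_pCons_left)
qed auto

text \<open>If \<open>g / t\<^sup>3\<close> has derivative \<open>q / t\<^sup>4\<close> and \<open>0 < a \<le> b \<le> c\<close> are the positive roots of
  \<open>q\<close>, then \<open>b\<close> is the local maximum of \<open>g / t\<^sup>3\<close> between two minima; choosing the constant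
  of integration such that \<open>b\<close> becomes a double root of \<open>g\<close> leaves two further nonnegative roots.\<close>

lemma quartic_extension_generic:
  fixes a b c e g0 :: real
  assumes abc: "0 \<le> a" "a \<le> b" "b \<le> c" and g0: "g0 \<noteq> 0"
    and Q: "[:- 3 * g4, - 2 * g3, - g2, 0, g0:] = smult g0 (\<Prod>x\<leftarrow>[a, b, c, e]. [:- x, 1:])"
  shows "\<exists>g1. nonneg_rooted [:g4, g3, g2, g1, g0:] \<and> (g2 = 0 \<longrightarrow> g1 = 0)"
proof -
  define s p where "s = a + c" and "p = a * c"
  \<comment> \<open>The missing cubic term makes the four roots sum to zero.\<close>
  have e: "e = - (b + s)" using Q g0 by (simp add: s_def)
  have g2: "g2 = g0 * (b\<^sup>2 + b * s + s\<^sup>2 - p)"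
    and g3: "2 * g3 = - g0 * (s * (b\<^sup>2 + b * s + p))"
    and g4: "3 * g4 = g0 * (b * p * (b + s))"
    using Q unfolding e by (simp_all add: s_def p_def algebra_simps power2_eq_square)
  have pos: "0 \<le> p" "0 \<le> s" using abc by (auto simp: s_def p_def)
  have "0 \<le> (b - a) * (c - b)" using abc by simp
  then have p_le: "p \<le> b * s - b\<^sup>2" by (simp add: s_def p_def algebra_simps power2_eq_square)
  show ?thesis
  proof (cases "b = 0")
    case True
    with abc have a: "a = 0" by simp
    \<comment> \<open>Here a = b = 0, and the double root at 0 leaves a second double root at
      c.\<close>
    have "[:g4, g3, g2, - 2 * g0 * c, g0:] = smult g0 (\<Prod>x\<leftarrow>[0, 0, c, c]. [:- x, 1:])"
      using g2 g3 g4 True a by (simp add: s_def p_def algebra_simps power2_eq_square)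
    then have "nonneg_rooted [:g4, g3, g2, - 2 * g0 * c, g0:]"
      using abc g0 by (simp only:, intro nonneg_rooted_prod_linear) auto
    moreover have "g2 = 0 \<longrightarrow> c = 0"
      using g0 True a by (simp add: g2 s_def p_def)
    ultimately show ?thesis by (intro exI[of _ "- 2 * g0 * c"]) auto
  next
    case False
    with abc have b: "0 < b" by simp
    \<comment> \<open>Comparing \<open>g3\<close> and \<open>g4\<close> with the coefficients of g0
      (t - b)^2 (t^2 + u t + v) determines u and v, and N is 6 b^2 u. The quadratic factor has
      nonnegative roots once u \<le> 0 \<le> v and 4 v \<le> u^2.\<close>
    define N where "N = 4 * b * p + s * p - 3 * b\<^sup>2 * s - 3 * b * s\<^sup>2"
    define u v where "u = N / (6 * b\<^sup>2)" and "v = (b + s) * p / (3 * b)"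
    have "(4 * b + s) * p \<le> (4 * b + s) * (b * s - b\<^sup>2)"
      using pos b p_le by (intro mult_left_mono) auto
    then have N: "2 * b * s\<^sup>2 + 4 * b ^ 3 \<le> - N"
      by (simp add: N_def algebra_simps power2_eq_square power3_eq_cube)
    have nn: "0 \<le> 2 * b * s\<^sup>2 + 4 * b ^ 3" using b by simp
    with N have "N \<le> 0" by linarith
    then have u: "u \<le> 0" by (simp add: u_def divide_nonpos_nonneg)
    have v: "0 \<le> v" using pos b by (simp add: v_def)
    \<comment> \<open>For the discriminant, both v and N are estimated by the extreme value b s -
      b^2 of p, where the inequality becomes the nonnegativity of a square.\<close>
    have "48 * b ^ 3 * (b + s) * p \<le> 48 * b ^ 3 * (b + s) * (b * s - b\<^sup>2)"
      using pos b p_le by (intro mult_left_mono) auto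
    also have "\<dots> = (2 * b * s\<^sup>2 + 4 * b ^ 3)\<^sup>2 - 4 * b\<^sup>2 * (s\<^sup>2 - 4 * b\<^sup>2)\<^sup>2"
      by algebra
    also have "\<dots> \<le> (2 * b * s\<^sup>2 + 4 * b ^ 3)\<^sup>2" by simp
    also have "\<dots> \<le> (- N)\<^sup>2" using N nn by (rule power_mono)
    finally have "48 * b ^ 3 * (b + s) * p \<le> N\<^sup>2" by simp
    moreover have "4 * v * (36 * b ^ 4) = 48 * b ^ 3 * (b + s) * p"
      using b by (simp add: v_def field_simps power3_eq_cube power4_eq_xxxx)
    moreover have "u\<^sup>2 * (36 * b ^ 4) = N\<^sup>2"
      using b by (simp add: u_def power_divide power_mult_distrib)
    ultimately have "4 * v * (36 * b ^ 4) \<le> u\<^sup>2 * (36 * b ^ 4)" by (simp only:)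
    then have D: "4 * v \<le> u\<^sup>2" using b by simp
    define w where "w = sqrt (u\<^sup>2 - 4 * v)"
    have w2: "w * w = u\<^sup>2 - 4 * v" using D by (simp add: w_def)
    have "w \<le> sqrt (u\<^sup>2)" unfolding w_def using v by (intro real_sqrt_le_mono) simp
    with u have w: "0 \<le> w" "w \<le> - u" using D by (auto simp: w_def)
    define r1 r2 where "r1 = (- u - w) / 2" and "r2 = (- u + w) / 2"
    have r: "0 \<le> r1" "0 \<le> r2" using w by (auto simp: r1_def r2_def)
    have r12: "r1 + r2 = - u" "r1 * r2 = v"
      using w2 by (simp_all add: r1_def r2_def field_simps power2_eq_square)
    then have u': "u = - (r1 + r2)" by simp
    have bu: "6 * b\<^sup>2 * u = N" and bv: "3 * b * v = (b + s) * p"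
      using b by (simp_all add: u_def v_def)
    have f2: "g2 = g0 * (v - 2 * b * u + b\<^sup>2)"
    proof -
      have "3 * b * (v - 2 * b * u + b\<^sup>2) = 3 * b * v - 6 * b\<^sup>2 * u + 3 * b ^ 3"
        by (simp add: algebra_simps power2_eq_square power3_eq_cube)
      also have "\<dots> = 3 * b * (b\<^sup>2 + b * s + s\<^sup>2 - p)"
        unfolding bu bv N_def by (simp add: algebra_simps power2_eq_square power3_eq_cube)
      finally show ?thesis using b g2 by simp
    qed
    have f3: "g3 = g0 * (b\<^sup>2 * u - 2 * b * v)"
    proof -
      have "6 * (b\<^sup>2 * u - 2 * b * v) = 6 * b\<^sup>2 * u - 4 * (3 * b * v)" by simp
      also have "\<dots> = - 3 * (s * (b\<^sup>2 + b * s + p))"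
        unfolding bu bv N_def by (simp add: algebra_simps power2_eq_square)
      finally have "b\<^sup>2 * u - 2 * b * v = - (s * (b\<^sup>2 + b * s + p)) / 2" by simp
      with g3 show ?thesis by simp
    qed
    have f4: "g4 = g0 * (b\<^sup>2 * v)"
    proof -
      have "3 * (b\<^sup>2 * v) = b * (3 * b * v)" by (simp add: power2_eq_square)
      also have "\<dots> = b * p * (b + s)" unfolding bv by simp
      finally have "3 * (b\<^sup>2 * v) = b * p * (b + s)" .
      with g4 have "3 * g4 = g0 * (3 * (b\<^sup>2 * v))" by (simp only:)
      then show ?thesis by simp
    qed
    have "[:g4, g3, g2, g0 * (u - 2 * b), g0:] = smult g0 (\<Prod>x\<leftarrow>[b, b, r1, r2]. [:- x, 1:])"
      unfolding f2 f3 f4 r12(2)[symmetric] u'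
      by (simp add: algebra_simps power2_eq_square)
    then have "nonneg_rooted [:g4, g3, g2, g0 * (u - 2 * b), g0:]"
      using b r g0 by (simp only:, intro nonneg_rooted_prod_linear) auto
    moreover have "g2 \<noteq> 0"
    proof -
      have "s\<^sup>2 - p = a\<^sup>2 + a * c + c\<^sup>2" by (simp add: s_def p_def power2_eq_square algebra_simps)
      then have "0 \<le> s\<^sup>2 - p" using abc by simp
      moreover have "0 < b\<^sup>2 + b * s" using b pos by (simp add: add_pos_nonneg)
      ultimately show ?thesis using g0 by (simp add: g2)
    qed
    ultimately show ?thesis by blast
  qed
qed

text \<open>The limit case of the previous lemma in which \<open>c\<close> and \<open>e\<close> have moved to infinity.\<close>

lemma quartic_extension_degenerate:
  fixes a b g2 :: real
  assumes ab: "0 \<le> a" "a \<le> b" and g2: "g2 \<noteq> 0"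
    and Q: "[:- 3 * g4, - 2 * g3, - g2:] = smult (- g2) (\<Prod>x\<leftarrow>[a, b]. [:- x, 1:])"
  shows "\<exists>g1. nonneg_rooted [:g4, g3, g2, g1, 0:]"
proof -
  have g3: "g3 = - g2 * (a + b) / 2" and g4: "g4 = g2 * a * b / 3"
    using Q by (simp_all add: algebra_simps)
  show ?thesis
  proof (cases "b = 0")
    case True
    with ab have "[:g4, g3, g2, 0, 0:] = smult g2 (\<Prod>x\<leftarrow>[0, 0]. [:- x, 1:])"
      by (simp add: g3 g4)
    then have "nonneg_rooted [:g4, g3, g2, 0, 0:]"
      using g2 by (simp only:, intro nonneg_rooted_prod_linear) auto
    then show ?thesis ..
  next
    case False
    with ab have b: "0 < b" "a < 3 * b" by auto
    \<comment> \<open>Found by comparing coefficients with u (t - b)^2 (t - r), again with b as a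
      double root; a < 3 b gives \<open>u \<noteq> 0\<close> and \<open>r \<ge> 0\<close>.\<close>
    define u r where "u = g2 * (a - 3 * b) / (6 * b\<^sup>2)" and "r = 2 * a * b / (3 * b - a)"
    have u: "u \<noteq> 0" and r: "0 \<le> r" using b g2 ab by (auto simp: u_def r_def)
    have ur: "u * r = - g2 * a / (3 * b)"
      using b by (simp add: u_def r_def divide_simps) (simp add: algebra_simps power2_eq_square)
    have bu: "b * u = g2 * (a - 3 * b) / (6 * b)" "b\<^sup>2 * u = g2 * (a - 3 * b) / 6"
      using b by (simp_all add: u_def power2_eq_square)
    have "g2 = - (u * r) - 2 * (b * u)" unfolding ur bu using b by (simp add: field_simps)
    moreover have "g3 = b\<^sup>2 * u + 2 * b * (u * r)" unfolding ur bu g3 using b by (simp add: field_simps)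
    moreover have "g4 = - b\<^sup>2 * (u * r)" unfolding ur g4 using b by (simp add: field_simps power2_eq_square)
    ultimately have "[:g4, g3, g2, u, 0:] = smult u (\<Prod>x\<leftarrow>[b, b, r]. [:- x, 1:])"
      by (simp add: algebra_simps power2_eq_square)
    then have "nonneg_rooted [:g4, g3, g2, u, 0:]"
      using b r u by (simp only:, intro nonneg_rooted_prod_linear) auto
    then show ?thesis ..
  qed
qed

text \<open>\<open>Q\<close> is t g' - 3 g for \<open>g = [:g4, g3, g2, g1, g0:]\<close>, where
  \<open>g1\<close> cancels. So degree 3 cannot occur, and the degrees 4, 2, 1, 0 are treated
  separately. The sign condition leaves one root free in degree 4 and none in lower degrees.\<close>

lemma quartic_extension_nonneg:
  fixes g0 g2 g3 g4 c :: real
  defines "Q \<equiv> [:- 3 * g4, - 2 * g3, - g2, 0, g0:]"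
  assumes c: "c \<noteq> 0" and Q: "Q = smult c (\<Prod>x\<leftarrow>xs. [:- x, 1:])"
    and sign: "(if length xs = 4 then 3 else length xs) \<le> length (filter (\<lambda>x. 0 \<le> x) xs)"
  shows "\<exists>g1. nonneg_rooted [:g4, g3, g2, g1, g0:] \<and> (g2 = 0 \<longrightarrow> g3 = 0 \<longrightarrow> g4 = 0 \<longrightarrow> g1 = 0)"
proof -
  define ys where "ys = sort xs"
  from Q have Q: "Q = smult c (\<Prod>x\<leftarrow>ys. [:- x, 1:])" by (simp add: ys_def prod_list_map_sort)
  have "length (filter (\<lambda>x. 0 \<le> x) ys) = length (filter (\<lambda>x. 0 \<le> x) xs)"
    unfolding ys_def by (metis mset_filter mset_sort size_mset)
  with sign have sign: "(if length ys = 4 then 3 else length ys) \<le> length (filter (\<lambda>x. 0 \<le> x) ys)"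
    by (auto simp: ys_def split: if_splits)
  have sorted: "sorted ys" by (simp add: ys_def)
  have "degree Q = length ys" using Q c by (simp add: degree_prod_monic_linear)
  moreover have "lead_coeff (\<Prod>x\<leftarrow>ys. [:- x, 1:]) = 1"
    by (induction ys) (auto simp: lead_coeff_mult simp del: mult_pCons_left)
  then have lc: "lead_coeff Q = c" using Q by simp
  ultimately consider (4) "length ys = 4" "g0 \<noteq> 0" | (2) "length ys = 2" "g0 = 0" "g2 \<noteq> 0"
    | (1) "length ys = 1" "g0 = 0" "g2 = 0" "g3 \<noteq> 0" | (0) "g0 = 0" "g2 = 0" "g3 = 0" "g4 \<noteq> 0"
    using c by (fastforce simp: Q_def split: if_splits)
  then show ?thesis
  proof cases
    case 4
    \<comment> \<open>After sorting, the root of unrestricted sign comes first.\<close>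
    then obtain e a b d where ys: "ys = [e, a, b, d]"
      by (auto simp: length_Suc_conv numeral_eq_Suc)
    with 4 lc have "c = g0" by (simp add: Q_def)
    have "0 \<le> a" using sign sorted by (auto simp: ys split: if_splits)
    moreover have "a \<le> b" "b \<le> d" using sorted by (auto simp: ys)
    moreover have "[:- 3 * g4, - 2 * g3, - g2, 0, g0:] = smult g0 (\<Prod>x\<leftarrow>[a, b, d, e]. [:- x, 1:])"
    proof -
      have "(\<Prod>x\<leftarrow>[a, b, d, e]. [:- x, 1:]) = (\<Prod>x\<leftarrow>ys. [:- x, 1:])"
        unfolding ys list.map prod_list.Cons prod_list.Nil by (simp only: mult_ac)
      with Q show ?thesis by (simp only: Q_def \<open>c = g0\<close>)
    qed
    ultimately show ?thesis using quartic_extension_generic[of a b d g0 g4 g3 g2 e] 4 by blast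
  next
    case 2
    then obtain a b where ys: "ys = [a, b]" by (auto simp: length_Suc_conv numeral_eq_Suc)
    have "0 \<le> a" "a \<le> b" using sign sorted by (auto simp: ys split: if_splits)
    moreover have "c = - g2" using lc 2 by (simp add: Q_def)
    with Q 2 have "[:- 3 * g4, - 2 * g3, - g2:] = smult (- g2) (\<Prod>x\<leftarrow>[a, b]. [:- x, 1:])"
      by (simp add: Q_def ys)
    ultimately show ?thesis using quartic_extension_degenerate[of a b g2 g4 g3] 2 by auto
  next
    case 1
    then obtain a where ys: "ys = [a]" by (auto simp: length_Suc_conv)
    have a: "0 \<le> a" using sign by (auto simp: ys split: if_splits)
    have "c = - 2 * g3" using lc 1 by (simp add: Q_def)
    \<comment> \<open>The root of g3 t + g4 is 2/3 of the root a of - 2 g3 t - 3 g4.\<close>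
    with Q 1 have "[:g4, g3, g2, 0, g0:] = smult g3 (\<Prod>x\<leftarrow>[2 * a / 3]. [:- x, 1:])"
      by (simp add: Q_def ys)
    then have "nonneg_rooted [:g4, g3, g2, 0, g0:]"
      using a 1 by (simp only:, intro nonneg_rooted_prod_linear) auto
    then show ?thesis by blast
  next
    case 0
    then have "nonneg_rooted [:g4, g3, g2, 0, g0:]"
      by (simp add: nonneg_rooted_def map_poly_pCons)
    then show ?thesis by blast
  qed
qed

lemma prod_linear_reflect:
  "(\<Prod>x\<leftarrow>xs. [:- x, 1:]) \<circ>\<^sub>p [:0, -1:] = smult ((- 1) ^ length xs) (\<Prod>x\<leftarrow>map uminus xs. [:- x, 1 :: real:])"
proof (induction xs)
  case (Cons x xs)
  have "[:- x, 1:] \<circ>\<^sub>p [:0, -1:] = smult (- 1) [:- (- x), 1:]" by (simp add: pcompose_pCons)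
  then show ?case
    unfolding list.map prod_list.Cons pcompose_mult Cons.IH
    by (simp only: mult_smult_left mult_smult_right smult_smult list.size power_Suc power_add) simp
qed (simp add: one_pCons pcompose_pCons)

text \<open>The substitution t \<mapsto> - t exchanges the two signs of the roots; it negates only
  the odd coefficients \<open>g3\<close> and \<open>g1\<close>.\<close>

lemma quartic_extension:
  fixes g0 g2 g3 g4 c :: real
  defines "Q \<equiv> [:- 3 * g4, - 2 * g3, - g2, 0, g0:]"
  assumes "Q \<noteq> 0" "real_rooted Q" "roots_same_sign (if degree Q = 4 then 3 else degree Q) Q"
  shows "\<exists>g1. (nonpos_rooted [:g4, g3, g2, g1, g0:] \<or> nonneg_rooted [:g4, g3, g2, g1, g0:]) \<and>
    (g2 = 0 \<longrightarrow> g3 = 0 \<longrightarrow> g4 = 0 \<longrightarrow> g1 = 0)"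
proof -
  obtain c xs where xs: "mset xs = proots Q" "length xs = degree Q"
    "Q = smult c (\<Prod>x\<leftarrow>xs. [:- x, 1:])" and c: "c \<noteq> 0"
    using sorted_proots_factorization[OF assms(3,2)] assms(2) by (metis leading_coeff_0_iff)
  have filt: "size {#x \<in># proots Q. P x#} = length (filter P xs)" for P
    by (metis mset_filter size_mset xs(1))
  let ?m = "if length xs = 4 then 3 else length xs"
  from assms(4) consider "?m \<le> length (filter (\<lambda>x. 0 \<le> x) xs)" | "?m \<le> length (filter (\<lambda>x. x \<le> 0) xs)"
    unfolding roots_same_sign_def filt xs(2) by blast
  then show ?thesis
  proof cases
    case 1
    show ?thesis
      using quartic_extension_nonneg[OF c xs(3)[unfolded Q_def] 1] by blast
  next
    case 2
    have "Q \<circ>\<^sub>p [:0, -1:] = [:- 3 * g4, - 2 * (- g3), - g2, 0, g0:]"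
      by (simp add: Q_def pcompose_pCons)
    then have Q': "[:- 3 * g4, - 2 * (- g3), - g2, 0, g0:] =
        smult (c * (- 1) ^ length xs) (\<Prod>x\<leftarrow>map uminus xs. [:- x, 1:])"
      using arg_cong[OF xs(3), of "\<lambda>p. p \<circ>\<^sub>p [:0, -1:]"] by (simp only: pcompose_smult prod_linear_reflect smult_smult)
    have 2: "(if length (map uminus xs) = 4 then 3 else length (map uminus xs)) \<le>
        length (filter (\<lambda>x. 0 \<le> x) (map uminus xs))"
      using 2 by (auto simp: filter_map o_def split: if_splits)
    have "c * (- 1) ^ length xs \<noteq> 0" using c by simp
    from quartic_extension_nonneg[OF this Q' 2] obtain g1 where g1: "nonneg_rooted [:g4, - g3, g2, g1, g0:]"
      "g2 = 0 \<longrightarrow> - g3 = 0 \<longrightarrow> g4 = 0 \<longrightarrow> g1 = 0"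
      by blast
    have "[:g4, - g3, g2, g1, g0:] \<circ>\<^sub>p [:0, -1:] = [:g4, g3, g2, - g1, g0:]"
      by (simp add: pcompose_pCons)
    with g1 have "nonpos_rooted [:g4, g3, g2, - g1, g0:]"
      by (metis nonpos_rooted_reflect_iff)
    with g1(2) show ?thesis by (intro exI[of _ "- g1"]) auto
  qed
qed

section \<open>Diagonal maps\<close>

definition diag_map :: "nat \<Rightarrow> nat \<Rightarrow> (nat \<Rightarrow> real) \<Rightarrow> real poly \<Rightarrow> real poly" where
  "diag_map n d \<gamma> p = (\<Sum>k\<le>d. monom (\<gamma> k * coeff p (n - k)) (d - k))"

lemma coeff_sum_monom_rev:
  assumes "d \<le> (m :: nat)"
  shows "coeff (\<Sum>k\<le>d. monom (f k) (m - k)) j = (if j \<le> m \<and> m - j \<le> d then f (m - j) else (0 :: real))"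
proof -
  have "coeff (\<Sum>k\<le>d. monom (f k) (m - k)) j = (\<Sum>k\<le>d. if k = m - j then (if j \<le> m then f k else 0) else 0)"
    unfolding coeff_sum using assms by (intro sum.cong) auto
  then show ?thesis by simp
qed

lemma coeff_diag_map:
  "coeff (diag_map n d \<gamma> p) j = (if j \<le> d then \<gamma> (d - j) * coeff p (n - (d - j)) else 0)"
  by (simp add: diag_map_def coeff_sum_monom_rev)

lemma degree_diag_map_le: "degree (diag_map n d \<gamma> p) \<le> d"
  by (rule degree_le) (simp add: coeff_diag_map)

lemma diag_map_add: "diag_map n d \<gamma> (p + q) = diag_map n d \<gamma> p + diag_map n d \<gamma> q"
  by (rule poly_eqI) (simp add: coeff_diag_map algebra_simps)

lemma diag_map_smult: "diag_map n d \<gamma> (smult c p) = smult c (diag_map n d \<gamma> p)"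
  by (rule poly_eqI) (simp add: coeff_diag_map)

lemma linear_map_between_diag_map:
  "linear_map_between (polys_upto n) (polys_upto d) (diag_map n d \<gamma>)"
  by (auto simp: linear_map_between_def polys_upto_def degree_diag_map_le diag_map_add diag_map_smult)

lemma diag_map_monom:
  assumes "d \<le> n" "k \<le> n"
  shows "diag_map n d \<gamma> (monom c (n - k)) = (if k \<le> d then monom (\<gamma> k * c) (d - k) else 0)"
  using assms by (intro poly_eqI) (auto simp: coeff_diag_map)

lemma diagonal_diag_map: "d \<le> n \<Longrightarrow> diagonal n d (diag_map n d \<gamma>)"
  by (auto simp: diagonal_def linear_map_between_diag_map diag_map_monom intro!: exI[of _ \<gamma>])

lemma polys_upto0_iff:
  assumes "1 \<le> n"
  shows "p \<in> polys_upto0 n \<longleftrightarrow> degree p \<le> n \<and> coeff p (n - 1) = 0"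
  using assms by (auto simp: polys_upto0_def polys_upto_def Suc_le_eq)

lemma linear_map_between_sum:
  assumes T: "linear_map_between V W T" and V: "0 \<in> V" "\<And>p q. p \<in> V \<Longrightarrow> q \<in> V \<Longrightarrow> p + q \<in> V"
    and f: "\<And>i. i \<in> A \<Longrightarrow> f i \<in> V"
  shows "T (sum f A) = (\<Sum>i\<in>A. T (f i))"
proof -
  have "T 0 = 0"
    using T V(1) unfolding linear_map_between_def by (metis smult_0_left)
  then have "sum f A \<in> V \<and> T (sum f A) = (\<Sum>i\<in>A. T (f i))"
    using f
    by (induction A rule: infinite_finite_induct) (use T V in \<open>auto simp: linear_map_between_def\<close>)
  then show ?thesis ..
qed

text \<open>The monomials of degree at most \<open>n\<close> other than t^(n-1) span
  \<open>polys_upto0 n\<close>.\<close>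

lemma linear_map_eqI:
  assumes n: "1 \<le> n"
    and T: "linear_map_between (polys_upto0 n) W T" and S: "linear_map_between (polys_upto0 n) W' S"
    and eq: "\<And>k. k \<le> n \<Longrightarrow> k \<noteq> 1 \<Longrightarrow> T (monom 1 (n - k)) = S (monom 1 (n - k))"
    and p: "p \<in> polys_upto0 n"
  shows "T p = S p"
proof -
  let ?V = "polys_upto0 n"
  have V: "0 \<in> ?V" "\<And>p q. p \<in> ?V \<Longrightarrow> q \<in> ?V \<Longrightarrow> p + q \<in> ?V"
    by (auto simp: polys_upto0_def polys_upto_def degree_add_le)
  have mV: "monom (coeff p j) j \<in> ?V" if "j \<le> n" for j
    using that p n degree_monom_le[of "coeff p j" j] by (auto simp: polys_upto0_iff)
  have "T (monom (coeff p j) j) = S (monom (coeff p j) j)" if j: "j \<le> n" for j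
  proof (cases "Suc j = n")
    case True
    then have "coeff p j = 0" using p by (simp add: polys_upto0_def)
    moreover have "T 0 = 0" "S 0 = 0"
      using T S V(1) unfolding linear_map_between_def by (metis smult_0_left)+
    ultimately show ?thesis by simp
  next
    case False
    have "(monom 1 j :: real poly) \<in> ?V"
      using False j n degree_monom_le[of "1::real" j] by (auto simp: polys_upto0_iff)
    then have "T (smult (coeff p j) (monom 1 j)) = smult (coeff p j) (T (monom 1 j))"
      "S (smult (coeff p j) (monom 1 j)) = smult (coeff p j) (S (monom 1 j))"
      using T S by (auto simp: linear_map_between_def)
    moreover have "T (monom 1 j) = S (monom 1 j)"
      using eq[of "n - j"] j False by auto
    ultimately show ?thesis by (simp add: smult_monom)
  qed
  moreover have "p = (\<Sum>j\<le>n. monom (coeff p j) j)"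
    using p by (simp add: polys_upto0_def polys_upto_def poly_as_sum_of_monoms')
  ultimately show ?thesis
    using linear_map_between_sum[OF T V, of "{..n}" "\<lambda>j. monom (coeff p j) j"]
      linear_map_between_sum[OF S V, of "{..n}" "\<lambda>j. monom (coeff p j) j"] mV by simp
qed

text \<open>On \<open>polys_upto0 n\<close> the weight at index 1 only meets a zero coefficient, so
  it can be normalized to 0.\<close>

lemma diagonal0_eq_diag_map:
  assumes "1 \<le> n" "d \<le> n" "diagonal0 n d T"
  obtains \<gamma> where "\<gamma> 1 = 0" "\<And>p. p \<in> polys_upto0 n \<Longrightarrow> T p = diag_map n d \<gamma> p"
proof -
  obtain \<gamma> where \<gamma>: "\<And>k. k \<le> d \<Longrightarrow> k \<noteq> 1 \<Longrightarrow> T (monom 1 (n - k)) = monom (\<gamma> k) (d - k)"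
    "\<And>k. k \<le> n \<Longrightarrow> d < k \<Longrightarrow> k \<noteq> 1 \<Longrightarrow> T (monom 1 (n - k)) = 0"
    using assms(3) by (auto simp: diagonal0_def)
  show ?thesis
  proof
    fix p assume p: "p \<in> polys_upto0 n"
    show "T p = diag_map n d (\<gamma>(1 := 0)) p"
    proof (rule linear_map_eqI[OF assms(1) _ _ _ p])
      show "linear_map_between (polys_upto0 n) (polys_upto0 d) T"
        using assms(3) by (simp add: diagonal0_def)
      show "linear_map_between (polys_upto0 n) UNIV (diag_map n d (\<gamma>(1 := 0)))"
        by (auto simp: linear_map_between_def diag_map_add diag_map_smult)
    qed (use \<gamma> assms(2) in \<open>auto simp: diag_map_monom\<close>)
  qed auto
qed

text \<open>This is \<open>Schur_Szego'\<close> for p(-t): the reflection absorbs the alternating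
  signs in \<open>G\<close>, and the scaled polynomial is, up to sign, t^(n-d) times the image of
  \<open>p\<close>.\<close>

lemma diag_map_real_rooted:
  assumes "d \<le> n" "real_rooted p" "degree p \<le> n"
    and G: "nonpos_rooted G \<or> nonneg_rooted G"
      "G = (\<Sum>k\<le>d. monom ((- 1) ^ k * real (n choose k) * \<gamma> k) (n - k))"
  shows "real_rooted (diag_map n d \<gamma> p)"
proof -
  define \<delta> where "\<delta> j = (if n - d \<le> j \<and> j \<le> n then (- 1) ^ (n - j) * \<gamma> (n - j) else 0)" for j
  let ?p = "p \<circ>\<^sub>p [:0, -1:]"
  have G_coeff: "coeff G j = (if j \<le> n then real (n choose j) * \<delta> j else 0)" for j
    using assms(1) by (auto simp: G(2) coeff_sum_monom_rev \<delta>_def binomial_symmetric[of j n])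
  have "real_rooted (scale_coeffs \<delta> ?p)"
  proof (rule Schur_Szego')
    show "real_rooted ?p" using assms(2) by (simp add: real_rooted_reflect_iff)
    show "degree ?p \<le> n"
      using assms(3) by (intro degree_le) (simp add: coeff_reflect coeff_eq_0)
    show "degree G \<le> n" by (rule degree_le) (simp add: G_coeff)
    show "nonpos_rooted G \<or> nonneg_rooted G" by (rule G(1))
  qed (simp add: G_coeff)
  also have "scale_coeffs \<delta> ?p = smult ((- 1) ^ n) (monom 1 (n - d) * diag_map n d \<gamma> p)"
  proof (rule poly_eqI)
    fix j
    have sgn: "(- 1) ^ (n - j) * (- 1) ^ j = ((- 1) ^ n :: real)" if "j \<le> n"
      using that by (metis le_add_diff_inverse2 power_add)
    show "coeff (scale_coeffs \<delta> ?p) j = coeff (smult ((- 1) ^ n) (monom 1 (n - d) * diag_map n d \<gamma> p)) j"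
    proof (cases "n - d \<le> j \<and> j \<le> n")
      case True
      then have *: "d - (j - (n - d)) = n - j" "n - (n - j) = j" "j - (n - d) \<le> d"
        using assms(1) by auto
      have "coeff (scale_coeffs \<delta> ?p) j = ((- 1) ^ (n - j) * (- 1) ^ j) * (\<gamma> (n - j) * coeff p j)"
        using True by (simp add: \<delta>_def coeff_reflect)
      also have "\<dots> = (- 1) ^ n * (\<gamma> (n - j) * coeff p j)" using sgn True by simp
      finally show ?thesis
        using True by (simp add: coeff_monom_mult coeff_diag_map *)
    qed (use assms(1) in \<open>auto simp: \<delta>_def coeff_monom_mult coeff_diag_map\<close>)
  qed
  finally show ?thesis
    by (simp add: real_rooted_smult_iff real_rooted_monom_mult_iff)
qed

section \<open>The test polynomial and the choice of the missing weight\<close>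

lemma coeff_power_linear_minus:
  assumes "k \<le> n"
  shows "coeff ([:- 1, 1 :: real:] ^ n) (n - k) = (- 1) ^ k * real (n choose k)"
  using coeff_linear_poly_power[of "n - k" n "- 1" "1::real"] assms
  by (simp add: binomial_symmetric[of k n])

text \<open>Since t + n - 1 = (t - 1) + n, the polynomial is (t - 1)^n + n (t - 1)^(n-1), and the
  second summand contributes - k times the coefficient of the first.\<close>

lemma coeff_test_poly:
  assumes "1 \<le> n" "k \<le> n"
  shows "coeff ([:- 1, 1:] ^ (n - 1) * [:real n - 1, 1:]) (n - k) = (- 1) ^ k * (1 - real k) * real (n choose k)"
proof -
  obtain m where n: "n = Suc m" using assms(1) by (cases n) auto
  have "[:- 1, 1:] ^ (n - 1) * [:real n - 1, 1:] = [:- 1, 1:] ^ n + smult (real n) ([:- 1, 1:] ^ m)"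
  proof -
    have "[:real n - 1, 1:] = [:- 1, 1:] + [:real n:]" by simp
    then show ?thesis unfolding n
      by (simp only: distrib_left power_Suc2 diff_Suc_1) simp
  qed
  moreover have "real n * coeff ([:- 1, 1:] ^ m) (n - k) = - ((- 1) ^ k * real k * real (n choose k))"
  proof (cases k)
    case 0
    then show ?thesis by (simp add: n coeff_eq_0 degree_power_eq)
  next
    case (Suc j)
    have "real n * real (m choose j) = real k * real (n choose k)"
      unfolding Suc n using Suc_times_binomial[of j m] by (metis of_nat_mult)
    then show ?thesis
      using coeff_power_linear_minus[of j m] assms(2) by (simp add: n Suc del: of_nat_Suc binomial_Suc_Suc)
  qed
  ultimately show ?thesis
    using coeff_power_linear_minus[OF assms(2)] by (simp add: algebra_simps)
qed

lemma test_poly_in_hyp0: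
  assumes "1 \<le> n"
  shows "[:- 1, 1:] ^ (n - 1) * [:real n - 1, 1:] \<in> hyp0 n"
proof -
  let ?f = "[:- 1, 1:] ^ (n - 1) * [:real n - 1, 1:]"
  have "degree ?f \<le> n"
    using assms by (intro order_trans[OF degree_mult_le]) (simp add: degree_power_eq)
  moreover have "coeff ?f (n - 1) = 0" using coeff_test_poly[of n 1] assms by simp
  moreover have "real_rooted ?f" by (intro real_rooted_mult real_rooted_power real_rooted_linear)
  ultimately show ?thesis using assms by (simp add: hyp0_def polys_upto0_iff)
qed

text \<open>Multiplication by \<open>t\<^bsup>4 - d\<^esup>\<close> reduces all \<open>d \<le> 4\<close> to quartics.\<close>

lemma quartic_of_test_poly:
  fixes \<gamma> :: "nat \<Rightarrow> real"
  assumes "1 \<le> n" "d \<le> n" "d \<le> 4"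
  defines "g \<equiv> \<lambda>k. if k \<le> d then (- 1) ^ k * real (n choose k) * \<gamma> k else 0"
  shows "monom 1 (4 - d) * diag_map n d \<gamma> ([:- 1, 1:] ^ (n - 1) * [:real n - 1, 1:]) =
    [:- 3 * g 4, - 2 * g 3, - g 2, 0, g 0:]"
proof -
  let ?f = "[:- 1, 1:] ^ (n - 1) * [:real n - 1, 1:]"
  have "coeff (monom 1 (4 - d) * diag_map n d \<gamma> ?f) (4 - k) = (1 - real k) * g k" if "k \<le> 4" for k
  proof (cases "k \<le> d")
    case True
    then have "4 - k - (4 - d) = d - k" "d - (d - k) = k" "\<not> 4 - k < 4 - d" using assms by auto
    then show ?thesis
      using True that assms coeff_test_poly[of n k]
      by (simp add: coeff_monom_mult coeff_diag_map g_def del: mult_pCons_right)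
  qed (use that assms in \<open>auto simp: coeff_monom_mult g_def\<close>)
  from this[of 0] this[of 1] this[of 2] this[of 3] this[of 4]
  have *: "coeff (monom 1 (4 - d) * diag_map n d \<gamma> ?f) 4 = g 0"
    "coeff (monom 1 (4 - d) * diag_map n d \<gamma> ?f) 3 = 0"
    "coeff (monom 1 (4 - d) * diag_map n d \<gamma> ?f) 2 = - g 2"
    "coeff (monom 1 (4 - d) * diag_map n d \<gamma> ?f) 1 = - 2 * g 3"
    "coeff (monom 1 (4 - d) * diag_map n d \<gamma> ?f) 0 = - 3 * g 4"
    by (simp_all del: mult_pCons_right)
  have deg: "degree (monom 1 (4 - d) * diag_map n d \<gamma> ?f) \<le> 4"
    using degree_diag_map_le[of n d \<gamma> ?f] assms(3)
    by (intro order_trans[OF degree_mult_le]) (simp add: degree_monom_eq)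
  show ?thesis
  proof (rule poly_eqI)
    fix j :: nat
    consider "j = 0" | "j = 1" | "j = 2" | "j = 3" | "j = 4" | "4 < j" by linarith
    then show "coeff (monom 1 (4 - d) * diag_map n d \<gamma> ?f) j = coeff [:- 3 * g 4, - 2 * g 3, - g 2, 0, g 0:] j"
      by cases (use * deg in \<open>auto simp: coeff_eq_0 numeral_eq_Suc simp del: mult_pCons_right\<close>)
  qed
qed

text \<open>The factor t^(4-d) adds 4 - d zero roots. They count for either sign, so the counts keep
  up with the raised bound.\<close>

lemma roots_same_sign_shift:
  assumes "q \<noteq> 0" "degree q \<le> d" "d \<le> 4" "all_but_one_root_same_sign d q"
  defines "Q \<equiv> monom 1 (4 - d) * q"
  shows "roots_same_sign (if degree Q = 4 then 3 else degree Q) Q"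
proof -
  have "proots (monom 1 (4 - d) :: real poly) = replicate_mset (4 - d) 0"
    by (simp add: monom_altdef proots_power)
  then have pr: "proots Q = replicate_mset (4 - d) 0 + proots q"
    using assms(1) by (simp add: Q_def proots_mult)
  have deg: "degree Q = 4 - d + degree q"
    using assms(1) by (simp add: Q_def degree_mult_eq degree_monom_eq)
  have "size {#x \<in># replicate_mset k (0 :: real). 0 \<le> x#} = k" "size {#x \<in># replicate_mset k (0 :: real). x \<le> 0#} = k"
    for k
    by (induction k) auto
  then show ?thesis
    using assms(2-4) unfolding all_but_one_root_same_sign_def roots_same_sign_def pr deg
    by (auto split: if_splits)
qed

text \<open>\<open>quartic_extension\<close> supplies the weight at index 1, and
  \<open>diag_map_real_rooted\<close> turns the common sign of the roots into preservation.\<close>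

lemma diag_map_extension:
  assumes n: "1 \<le> n" "d \<le> n" "d \<le> 4"
  defines "f \<equiv> [:- 1, 1:] ^ (n - 1) * [:real n - 1, 1:]"
  assumes \<gamma>: "\<gamma> 1 = 0" and q: "real_rooted (diag_map n d \<gamma> f)" "all_but_one_root_same_sign d (diag_map n d \<gamma> f)"
  obtains \<gamma>' where "\<And>k. k \<noteq> 1 \<Longrightarrow> \<gamma>' k = \<gamma> k"
    "\<And>p. real_rooted p \<Longrightarrow> degree p \<le> n \<Longrightarrow> real_rooted (diag_map n d \<gamma>' p)"
proof (cases "diag_map n d \<gamma> f = 0")
  case True
  \<comment> \<open>The factor \<open>1 - real k\<close> from \<open>coeff_test_poly\<close> is
    nonzero for \<open>k \<noteq> 1\<close>, so a zero image forces all weights to vanish.\<close>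
  have "\<gamma> k = 0" if "k \<le> d" for k
  proof (cases "k = 1")
    case False
    have "coeff (diag_map n d \<gamma> f) (d - k) = 0" by (simp add: True)
    then have "\<gamma> k * ((- 1) ^ k * (1 - real k) * real (n choose k)) = 0"
      using that n coeff_test_poly[of n k] by (simp add: coeff_diag_map f_def)
    with False that n show ?thesis by simp
  qed (use \<gamma> in simp)
  then have "diag_map n d \<gamma> p = 0" for p by (simp add: diag_map_def)
  then show ?thesis using that[of \<gamma>] by simp
next
  case False
  define g where "g = (\<lambda>k. if k \<le> d then (- 1) ^ k * real (n choose k) * \<gamma> k else 0)"
  define Q where "Q = [:- 3 * g 4, - 2 * g 3, - g 2, 0, g 0:]"
  have Q: "Q = monom 1 (4 - d) * diag_map n d \<gamma> f"
    unfolding Q_def f_def g_def using quartic_of_test_poly[OF n] by simp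
  have "Q \<noteq> 0" using False by (simp add: Q)
  moreover have "real_rooted Q" using q(1) by (simp add: Q real_rooted_monom_mult_iff)
  moreover have "roots_same_sign (if degree Q = 4 then 3 else degree Q) Q"
    unfolding Q using roots_same_sign_shift[OF False degree_diag_map_le n(3) q(2)] .
  ultimately obtain g1 where g1: "nonpos_rooted [:g 4, g 3, g 2, g1, g 0:] \<or> nonneg_rooted [:g 4, g 3, g 2, g1, g 0:]"
    "g 2 = 0 \<longrightarrow> g 3 = 0 \<longrightarrow> g 4 = 0 \<longrightarrow> g1 = 0"
    unfolding Q_def using quartic_extension by blast
  \<comment> \<open>Chosen so that the term - n \<gamma>'(1) of \<open>G\<close> becomes
    \<open>g1\<close>.\<close>
  define \<gamma>' where "\<gamma>' = \<gamma>(1 := - g1 / real n)"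
  define h where "h = g(1 := g1)"
  define G where "G = (\<Sum>k\<le>d. monom ((- 1) ^ k * real (n choose k) * \<gamma>' k) (n - k))"
  define P where "P = [:g 4, g 3, g 2, g1, g 0:]"
  have G: "G = (\<Sum>k\<le>d. monom (h k) (n - k))"
    unfolding G_def using n(1) by (intro sum.cong refl) (auto simp: h_def g_def \<gamma>'_def)
  \<comment> \<open>For \<open>d = 0\<close> the index 1 lies beyond \<open>d\<close>; then
    \<open>g 2\<close>, \<open>g 3\<close>, \<open>g 4\<close> vanish, and the implication obtained
    with \<open>g1\<close> gives \<open>h 1 = 0\<close>.\<close>
  have hz: "h k = 0" if "d < k" for k
    using that g1(2) by (auto simp: h_def g_def)
  have "P = (\<Sum>k\<le>4. monom (h k) (4 - k))"
    by (simp add: P_def h_def numeral_eq_Suc monom_Suc monom_0)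
  also have "\<dots> = (\<Sum>k\<le>d. monom (h k) (4 - k))"
    using n(3) hz by (intro sum.mono_neutral_right) auto
  \<comment> \<open>\<open>P\<close> and \<open>G\<close> differ by a power of t; cross
    multiplication avoids distinguishing \<open>n < 4\<close> from \<open>n > 4\<close>.\<close>
  finally have "monom 1 n * P = (\<Sum>k\<le>d. monom (h k) (n + 4 - k))"
    using n by (auto simp: sum_distrib_left mult_monom intro!: sum.cong)
  also have "\<dots> = monom 1 4 * G"
    using n by (auto simp: G sum_distrib_left mult_monom add.commute intro!: sum.cong)
  finally have "cpoly (monom 1 n * P) = cpoly (monom 1 4 * G)" by simp
  then have eq: "z ^ n * poly (cpoly P) z = z ^ 4 * poly (cpoly G) z" for z
    by (simp add: cpoly_mult map_poly_monom poly_monom)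
      (metis mult_1 of_real_1 poly_monom poly_mult)
  have "z = 0 \<or> poly (cpoly P) z = 0" if "poly (cpoly G) z = 0" for z
    using eq[of z] that by auto
  with g1(1) have "nonpos_rooted G \<or> nonneg_rooted G"
    unfolding nonpos_rooted_def nonneg_rooted_def P_def by fastforce
  then have "real_rooted (diag_map n d \<gamma>' p)" if "real_rooted p" "degree p \<le> n" for p
    using diag_map_real_rooted[OF n(2) that _ G_def] by blast
  then show ?thesis using that[of \<gamma>'] by (auto simp: \<gamma>'_def)
qed

section \<open>Necessity of the sign condition\<close>

lemma length_filter_nonneg_nonpos:
  "length xs \<le> length (filter (\<lambda>x. 0 \<le> x) xs) + length (filter (\<lambda>x. x \<le> (0::real)) xs)"
  by (induction xs) auto

text \<open>The nonnegative and the nonpositive roots together number at least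
  \<open>degree q\<close>, and degree d - 1 is excluded. If both counts miss the bound, this leaves
  d = 4 with two negative and two positive roots, or with degree 2 and one root of each strict sign.
  The conclusion records the sign of the product of the roots.\<close>

lemma not_all_but_one_root_same_sign:
  assumes q: "real_rooted q" "q \<in> polys_upto0 d" "d \<le> 4" and neg: "\<not> all_but_one_root_same_sign d q"
  shows "d = 4 \<and> (0 < coeff q 4 * coeff q 0 \<or> coeff q 4 = 0 \<and> coeff q 2 * coeff q 0 < 0)"
proof -
  have "q \<noteq> 0"
    using neg by (auto simp: all_but_one_root_same_sign_def roots_same_sign_def split: if_splits)
  obtain xs where xs: "sorted xs" "mset xs = proots q" "length xs = degree q"
    "q = smult (lead_coeff q) (\<Prod>x\<leftarrow>xs. [:- x, 1:])"
    using sorted_proots_factorization[OF q(1) \<open>q \<noteq> 0\<close>] .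
  have filt: "size {#x \<in># proots q. P x#} = length (filter P xs)" for P
    by (metis mset_filter size_mset xs(2))
  define m where "m = (if degree q = d then d - 1 else degree q)"
  have less: "length (filter (\<lambda>x. 0 \<le> x) xs) < m" "length (filter (\<lambda>x. x \<le> 0) xs) < m"
    using neg by (auto simp: all_but_one_root_same_sign_def roots_same_sign_def filt m_def)
  have deg: "degree q \<le> d" using q(2) by (simp add: polys_upto0_def polys_upto_def)
  have "Suc (degree q) \<noteq> d"
    using q(2) \<open>q \<noteq> 0\<close> by (auto simp: polys_upto0_def)
  with less deg length_filter_nonneg_nonpos[of xs] q(3) xs(3)
  have d: "d = 4" "length xs = 4 \<or> length xs = 2"
    by (auto simp: m_def split: if_splits)
  define c where "c = lead_coeff q"
  have c: "c \<noteq> 0" using \<open>q \<noteq> 0\<close> by (simp add: c_def)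
  note fac = xs(4)[folded c_def]
  from d(2) show ?thesis
  proof
    assume len: "length xs = 4"
    then obtain x1 x2 x3 x4 where l: "xs = [x1, x2, x3, x4]"
      by (auto simp: length_Suc_conv numeral_eq_Suc)
    have "x2 < 0"
      using less(1) xs(1,3) d(1) by (rule_tac ccontr) (auto simp: l m_def split: if_splits)
    moreover have "0 < x3"
      using less(2) xs(1,3) d(1) by (rule_tac ccontr) (auto simp: l m_def split: if_splits)
    ultimately have "0 < (x1 * x2) * (x3 * x4)"
      using xs(1) by (intro mult_pos_pos mult_neg_neg) (auto simp: l)
    with c have "0 < c\<^sup>2 * ((x1 * x2) * (x3 * x4))" by simp
    moreover have "coeff q 4 = c" using xs(3) len by (simp add: c_def)
    moreover have "coeff q 0 = c * (x1 * x2 * x3 * x4)" by (subst fac) (simp add: l)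
    ultimately have "0 < coeff q 4 * coeff q 0" by (simp add: power2_eq_square mult_ac)
    with d show ?thesis by blast
  next
    assume len: "length xs = 2"
    then obtain x1 x2 where l: "xs = [x1, x2]"
      by (auto simp: length_Suc_conv numeral_eq_Suc)
    have "x1 < 0"
      using less(1) xs(1,3) d(1) by (rule_tac ccontr) (auto simp: l m_def split: if_splits)
    moreover have "0 < x2"
      using less(2) xs(1,3) d(1) by (rule_tac ccontr) (auto simp: l m_def split: if_splits)
    ultimately have "x1 * x2 < 0" by (rule mult_neg_pos)
    with c have "c\<^sup>2 * (x1 * x2) < 0" by (simp add: mult_pos_neg)
    moreover have "coeff q 2 = c" using xs(3) len by (simp add: c_def)
    moreover have "coeff q 0 = c * (x1 * x2)" by (subst fac) (simp add: l)
    moreover have "coeff q 4 = 0" using xs(3) len by (intro coeff_eq_0) simp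
    ultimately show ?thesis using d by (simp add: power2_eq_square mult_ac)
  qed
qed

text \<open>As a polynomial in y = z^2 it has a negative root y, which yields the purely imaginary
  root z = i sqrt(-y).\<close>

lemma not_real_rooted_biquadratic:
  assumes "A * C < 0 \<or> A = 0 \<and> 0 < B * C"
  shows "\<not> real_rooted [:C, 0, B, 0, A:]"
proof -
  have "\<exists>y<0. A * y\<^sup>2 + B * y + C = 0"
  proof (cases "A = 0")
    case True
    with assms have "- C / B < 0" "A * (- C / B)\<^sup>2 + B * (- C / B) + C = 0"
      by (auto simp: divide_less_0_iff zero_less_divide_iff zero_less_mult_iff)
    then show ?thesis by blast
  next
    case False
    with assms have AC: "A * C < 0" by blast
    define w where "w = sqrt (B\<^sup>2 - 4 * A * C)"
    have "sqrt (B\<^sup>2) < w" unfolding w_def using AC by (intro real_sqrt_less_mono) simp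
    then have w: "\<bar>B\<bar> < w" by simp
    have "4 * A * C \<le> 0" using AC by (simp add: mult.assoc)
    also have "0 \<le> B\<^sup>2" by simp
    finally have w2: "w\<^sup>2 = B\<^sup>2 - 4 * A * C" by (simp add: w_def)
    define s where "s = sgn A"
    have s: "s * s = 1" using False by (simp add: s_def sgn_if)
    \<comment> \<open>The roots in y have the negative product C / A; the sign \<open>s\<close> of A
      selects the negative one.\<close>
    define y where "y = (- B - s * w) / (2 * A)"
    have "y < 0"
      using w False by (auto simp: y_def s_def sgn_if divide_less_0_iff)
    moreover have "A * y\<^sup>2 + B * y + C = 0"
    proof -
      have "2 * A * y = - B - s * w" using False by (simp add: y_def)
      then have "(2 * A * y + B)\<^sup>2 = (s * s) * w\<^sup>2" by (simp add: power_mult_distrib power2_eq_square)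
      then have "4 * A * (A * y\<^sup>2 + B * y + C) = 0"
        using s w2 by (simp add: power2_eq_square algebra_simps)
      with False show ?thesis by simp
    qed
    ultimately show ?thesis by blast
  qed
  then obtain y where y: "y < 0" "A * y\<^sup>2 + B * y + C = 0" by blast
  define z where "z = Complex 0 (sqrt (- y))"
  have z2: "z * z = complex_of_real y" using y by (simp add: z_def complex_eq_iff)
  have "poly (cpoly [:C, 0, B, 0, A:]) z = complex_of_real C + complex_of_real B * (z * z) + complex_of_real A * ((z * z) * (z * z))"
    by (simp add: map_poly_pCons algebra_simps)
  also have "\<dots> = complex_of_real (A * y\<^sup>2 + B * y + C)"
    unfolding z2 by (simp add: power2_eq_square)
  finally have "poly (cpoly [:C, 0, B, 0, A:]) z = 0" using y by simp
  moreover have "z \<notin> \<real>" using y by (simp add: z_def complex_is_Real_iff)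
  moreover have "[:C, 0, B, 0, A:] \<noteq> 0" using assms by auto
  ultimately show ?thesis unfolding real_rooted_def by blast
qed

text \<open>If the sign condition fails, the preceding lemmas give d = 4 and sign relations among
  the weights at 0, 2 and 4. These are just the relations under which the image of t^(n-4) (t^2 -
  1)^2 is a biquadratic with nonreal roots.\<close>

lemma preserver_sign_condition:
  assumes n: "1 \<le> n" "d \<le> n" "d \<le> 4"
    and pres: "\<And>p. p \<in> hyp0 n \<Longrightarrow> diag_map n d \<gamma> p \<in> hyp0 d"
  shows "all_but_one_root_same_sign d (diag_map n d \<gamma> ([:- 1, 1:] ^ (n - 1) * [:real n - 1, 1:]))"
proof (rule ccontr)
  define f where "f = [:- 1, 1:] ^ (n - 1) * [:real n - 1, 1:]"
  assume "\<not> all_but_one_root_same_sign d (diag_map n d \<gamma> ([:- 1, 1:] ^ (n - 1) * [:real n - 1, 1:]))"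
  moreover have "diag_map n d \<gamma> f \<in> hyp0 d"
    unfolding f_def by (intro pres test_poly_in_hyp0 n)
  ultimately have d: "d = 4" and sgn: "0 < coeff (diag_map n d \<gamma> f) 4 * coeff (diag_map n d \<gamma> f) 0 \<or>
      coeff (diag_map n d \<gamma> f) 4 = 0 \<and> coeff (diag_map n d \<gamma> f) 2 * coeff (diag_map n d \<gamma> f) 0 < 0"
    using not_all_but_one_root_same_sign[of "diag_map n d \<gamma> f" d] n(3) by (auto simp: hyp0_def f_def)
  have co: "coeff (diag_map n d \<gamma> f) (4 - k) = \<gamma> k * ((- 1) ^ k * (1 - real k) * real (n choose k))" if "k \<le> 4" for k
    using that n coeff_test_poly[of n k] by (simp add: d coeff_diag_map f_def)
  have "0 < real (n choose 2)" "0 < real (n choose 4)" using n d by auto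
  moreover have "coeff (diag_map n d \<gamma> f) 4 = \<gamma> 0" "coeff (diag_map n d \<gamma> f) 2 = - (\<gamma> 2 * real (n choose 2))"
    "coeff (diag_map n d \<gamma> f) 0 = - 3 * (\<gamma> 4 * real (n choose 4))"
    using co[of 0] co[of 2] co[of 4] by simp_all
  ultimately have "\<gamma> 0 * \<gamma> 4 < 0 \<or> \<gamma> 0 = 0 \<and> 0 < (- 2 * \<gamma> 2) * \<gamma> 4"
    using sgn by (auto simp: zero_less_mult_iff mult_less_0_iff)
  then have "\<not> real_rooted [:\<gamma> 4, 0, - 2 * \<gamma> 2, 0, \<gamma> 0:]"
    by (rule not_real_rooted_biquadratic)
  moreover have "diag_map n d \<gamma> (monom 1 (n - 4) * [:1, 0, - 2, 0, 1:]) = [:\<gamma> 4, 0, - 2 * \<gamma> 2, 0, \<gamma> 0:]"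
  proof -
    have "coeff (monom 1 (n - 4) * [:1, 0, - 2, 0, 1:]) (n - k) = coeff [:1, 0, - 2, 0, 1 :: real:] (4 - k)" if "k \<le> 4" for k
    proof -
      have "n - k - (n - 4) = 4 - k" "\<not> n - k < n - 4" using that n d by auto
      then show ?thesis by (simp add: coeff_monom_mult del: mult_pCons_right)
    qed
    then have "diag_map n d \<gamma> (monom 1 (n - 4) * [:1, 0, - 2, 0, 1:]) =
        (\<Sum>k\<le>4. monom (\<gamma> k * coeff [:1, 0, - 2, 0, 1:] (4 - k)) (4 - k))"
      by (simp add: diag_map_def d)
    also have "\<dots> = [:\<gamma> 4, 0, - 2 * \<gamma> 2, 0, \<gamma> 0:]"
      by (simp add: numeral_eq_Suc monom_Suc monom_0)
    finally show ?thesis .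
  qed
  moreover have "monom 1 (n - 4) * [:1, 0, - 2, 0, 1:] \<in> hyp0 n"
  proof -
    have "[:1, 0, - 2, 0, 1 :: real:] = [:- 1, 1:] * [:- 1, 1:] * ([:1, 1:] * [:1, 1:])" by simp
    then have "real_rooted [:1, 0, - 2, 0, 1:]"
      by (simp only:) (intro real_rooted_mult real_rooted_linear)
    moreover have "degree (monom 1 (n - 4) * [:1, 0, - 2, 0, 1 :: real:]) \<le> n"
      using n d by (intro order_trans[OF degree_mult_le]) (simp add: degree_monom_eq)
    moreover have "coeff (monom 1 (n - 4) * [:1, 0, - 2, 0, 1 :: real:]) (n - 1) = 0"
    proof -
      have "n - 1 - (n - 4) = 3" "\<not> n - 1 < n - 4" using n d by auto
      then show ?thesis by (simp add: coeff_monom_mult numeral_eq_Suc del: mult_pCons_right)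
    qed
    ultimately show ?thesis
      using n by (simp add: hyp0_def polys_upto0_iff real_rooted_monom_mult_iff del: mult_pCons_right)
  qed
  ultimately show False using pres unfolding hyp0_def by force
qed

section \<open>Newton's inequality and non-extendable preservers\<close>

lemma coeff_prod_list_pos:
  fixes ys :: "real list"
  assumes "\<And>y. y \<in> set ys \<Longrightarrow> 0 < y"
  shows "0 \<le> coeff (\<Prod>y\<leftarrow>ys. [:1, y:]) k \<and> (k \<le> length ys \<longrightarrow> 0 < coeff (\<Prod>y\<leftarrow>ys. [:1, y:]) k)"
  using assms
proof (induction ys arbitrary: k)
  case Nil
  then show ?case by (cases k) auto
next
  case (Cons y ys)
  then have y: "0 < y" and IH: "0 \<le> coeff (\<Prod>y\<leftarrow>ys. [:1, y:]) k"
    "k \<le> length ys \<longrightarrow> 0 < coeff (\<Prod>y\<leftarrow>ys. [:1, y:]) k" for k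
    by auto
  show ?case
    using y IH by (cases k) (auto simp: coeff_linear_mult simp del: mult_pCons_left intro!: add_nonneg_pos)
qed

lemma coeff_prod_list_012:
  fixes ys :: "real list"
  defines "P \<equiv> \<Prod>y\<leftarrow>ys. [:1, y:]"
  shows "coeff P 0 = 1" "coeff P 1 = sum_list ys" "2 * coeff P 2 = (sum_list ys)\<^sup>2 - (\<Sum>y\<leftarrow>ys. y\<^sup>2)"
  unfolding P_def
  by (induction ys)
    (auto simp: coeff_linear_mult numeral_2_eq_2 algebra_simps power2_eq_square simp del: mult_pCons_left)

text \<open>Dropping an entry y whose sign is opposite to that of the sum S can only increase S^2,
  and Cauchy--Schwarz then involves one entry fewer.\<close>

lemma sum_list_power2_le_of_mixed_signs:
  fixes ys :: "real list"
  assumes "\<exists>y\<in>set ys. y \<le> 0" "\<exists>y\<in>set ys. 0 \<le> y"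
  shows "(sum_list ys)\<^sup>2 \<le> (real (length ys) - 1) * (\<Sum>y\<leftarrow>ys. y\<^sup>2)"
proof -
  define S where "S = sum_list ys"
  obtain y where y: "y \<in> set ys" "y * S \<le> 0"
    using assms by (metis linorder_linear mult_nonneg_nonpos mult_nonneg_nonpos2 mult_nonpos_nonneg)
  define zs where "zs = remove1 y ys"
  have S: "S = y + sum_list zs"
    using sum_list_map_remove1[OF y(1), of "\<lambda>x. x"] by (simp add: S_def zs_def)
  have Q: "(\<Sum>y\<leftarrow>ys. y\<^sup>2) = y\<^sup>2 + (\<Sum>y\<leftarrow>zs. y\<^sup>2)"
    using sum_list_map_remove1[OF y(1), of "\<lambda>x. x\<^sup>2"] by (simp add: zs_def)
  have "length zs = length ys - 1" using y(1) by (simp add: zs_def length_remove1)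
  with length_pos_if_in_set[OF y(1)] have len: "real (length ys) = real (length zs) + 1" by linarith
  have "S\<^sup>2 \<le> S\<^sup>2 - 2 * (y * S) + y\<^sup>2" using y(2) zero_le_power2[of y] by linarith
  also have "\<dots> = (S - y)\<^sup>2" by (simp add: power2_diff)
  also have "\<dots> \<le> real (length zs) * (\<Sum>y\<leftarrow>zs. y\<^sup>2)"
    using sum_list_power2_le[of zs] by (simp add: S)
  also have "\<dots> \<le> real (length zs) * (\<Sum>y\<leftarrow>ys. y\<^sup>2)"
    by (intro mult_left_mono) (simp_all add: Q)
  finally show ?thesis by (simp add: S_def len)
qed

text \<open>In terms of the reciprocals \<open>y\<close> of the negated roots (zero for the missing ones), this is
  \<open>(\<Sum>y)\<^sup>2 \<le> (d - 1) \<Sum>y\<^sup>2\<close>. It beats Newton's inequality, where \<open>d - 1\<close> is replaced by \<open>d\<close>,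
  because the vanishing coefficient excludes that all \<open>y\<close> have the same strict sign.\<close>

lemma Newton_zero_sum:
  assumes r: "real_rooted r" "degree r \<le> d" and d: "2 \<le> d" and zero: "coeff r (d - 1) = 0"
  shows "2 * (real d - 1) * (coeff r 2 * coeff r 0) \<le> (real d - 2) * (coeff r 1)\<^sup>2"
proof (cases "coeff r 0 = 0")
  case True
  with d show ?thesis by simp
next
  case False
  obtain xs where xs: "length xs = degree r" "r = smult (lead_coeff r) (\<Prod>x\<leftarrow>xs. [:- x, 1:])"
    using real_rooted_factorization[OF r(1)] .
  define ys where "ys = map (\<lambda>x. - 1 / x) xs @ replicate (d - degree r) 0"
  define c where "c = lead_coeff r * (\<Prod>x\<leftarrow>xs. - x)"
  have nz: "x \<noteq> 0" if "x \<in> set xs" for x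
  proof
    assume "x = 0"
    with that have "poly (\<Prod>x\<leftarrow>xs. [:- x, 1:]) 0 = 0"
      by (induction xs) auto
    then have "poly r 0 = 0" by (subst xs(2)) simp
    with False show False by (simp add: poly_0_coeff_0)
  qed
  then have "(\<Prod>x\<leftarrow>xs. [:- x, 1:]) = smult (\<Prod>x\<leftarrow>xs. - x) (\<Prod>y\<leftarrow>map (\<lambda>x. - 1 / x) xs. [:1, y:])"
  proof (induction xs)
    case (Cons x xs)
    have "[:- x, 1:] = smult (- x) [:1, - 1 / x:]" using Cons.prems by simp
    moreover have "(\<Prod>x\<leftarrow>xs. [:- x, 1:]) =
        smult (\<Prod>x\<leftarrow>xs. - x) (\<Prod>y\<leftarrow>map (\<lambda>x. - 1 / x) xs. [:1, y:])"
      using Cons by auto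
    ultimately show ?case
      unfolding list.map prod_list.Cons
      by (simp only: mult_smult_left mult_smult_right smult_smult mult.commute)
  qed auto
  then have fac: "r = smult c (\<Prod>y\<leftarrow>ys. [:1, y:])"
    by (subst xs(2)) (simp add: c_def ys_def flip: one_pCons)
  with False have c: "c \<noteq> 0" by auto
  have len: "length ys = d" using r(2) xs(1) by (simp add: ys_def)
  have zero': "coeff (\<Prod>y\<leftarrow>ys. [:1, y:]) (d - 1) = 0"
    using zero c by (simp add: fac)
  \<comment> \<open>If all entries were positive, so would be their elementary symmetric function of
    order d - 1; negating the list treats the other sign.\<close>
  have "\<exists>y\<in>set ys. y \<le> 0"
    using coeff_prod_list_pos[of ys "d - 1"] zero' len by force
  moreover have "\<exists>y\<in>set ys. 0 \<le> y"
  proof (rule ccontr)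
    assume "\<not> (\<exists>y\<in>set ys. 0 \<le> y)"
    then have "0 < coeff (\<Prod>y\<leftarrow>map uminus ys. [:1, y:]) (d - 1)"
      using coeff_prod_list_pos[of "map uminus ys" "d - 1"] len by force
    also have "\<dots> = (- 1) ^ (d - 1) * coeff (\<Prod>y\<leftarrow>ys. [:1, y:]) (d - 1)"
      using coeff_prod_list_scale[of "- 1" "\<lambda>y. y" ys] by (simp add: o_def)
    finally show False using zero' by simp
  qed
  ultimately have *: "(sum_list ys)\<^sup>2 \<le> (real d - 1) * (\<Sum>y\<leftarrow>ys. y\<^sup>2)"
    using sum_list_power2_le_of_mixed_signs[of ys] len by simp
  define E1 E2 where "E1 = sum_list ys" and "E2 = coeff (\<Prod>y\<leftarrow>ys. [:1, y:]) 2"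
  have "(real d - 1) * (2 * E2) = (real d - 1) * E1\<^sup>2 - (real d - 1) * (\<Sum>y\<leftarrow>ys. y\<^sup>2)"
    unfolding E2_def coeff_prod_list_012(3) E1_def by (simp add: algebra_simps)
  also have "\<dots> \<le> (real d - 2) * E1\<^sup>2"
    using * by (simp add: E1_def algebra_simps)
  finally have "c\<^sup>2 * ((real d - 1) * (2 * E2)) \<le> c\<^sup>2 * ((real d - 2) * E1\<^sup>2)"
    by (intro mult_left_mono) auto
  moreover have "coeff r 0 = c" "coeff r 1 = c * E1" "coeff r 2 = c * E2"
    using coeff_prod_list_012(1,2)[of ys] by (simp_all add: fac E1_def E2_def)
  ultimately show ?thesis
    by (simp only:) (simp add: power2_eq_square mult_ac)
qed

section \<open>A preserver that cannot be extended\<close>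

lemma real_rooted_quadratic_iff:
  assumes "A \<noteq> 0"
  shows "real_rooted [:C, B, A:] \<longleftrightarrow> 4 * A * C \<le> B\<^sup>2"
proof
  assume rr: "real_rooted [:C, B, A:]"
  have deg: "degree [:C, B, A:] = 2" and lc: "lead_coeff [:C, B, A:] = A" using assms by auto
  obtain xs where xs: "length xs = degree [:C, B, A:]"
    "[:C, B, A:] = smult (lead_coeff [:C, B, A:]) (\<Prod>x\<leftarrow>xs. [:- x, 1:])"
    using real_rooted_factorization[OF rr] .
  then obtain x y where "xs = [x, y]" unfolding deg by (auto simp: length_Suc_conv numeral_2_eq_2)
  with xs(2) have B: "B = - A * (x + y)" and C: "C = A * x * y"
    unfolding lc by (simp_all add: algebra_simps)
  have "B\<^sup>2 - 4 * A * C = (A * (x - y))\<^sup>2"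
    unfolding B C by (simp add: power2_eq_square algebra_simps)
  then show "4 * A * C \<le> B\<^sup>2" by (metis diff_ge_0_iff_ge zero_le_power2)
next
  assume "4 * A * C \<le> B\<^sup>2"
  define w where "w = sqrt (B\<^sup>2 - 4 * A * C)"
  have w: "w * w = B * B - 4 * A * C"
    using \<open>4 * A * C \<le> B\<^sup>2\<close> by (simp add: w_def power2_eq_square)
  have "(B - w) * (B + w) = 4 * A * C" using w by (simp add: algebra_simps)
  then have "[:C, B, A:] = smult A ([:(B - w) / (2 * A), 1:] * [:(B + w) / (2 * A), 1:])"
    using assms by (simp add: field_simps)
  then show "real_rooted [:C, B, A:]"
    by (simp only:) (intro real_rooted_smult real_rooted_mult real_rooted_linear)
qed

text \<open>The root b^(1/m) exp(i pi / m) lies in the upper half plane, because m \<ge> 2.\<close>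

lemma not_real_rooted_monom_plus_const:
  assumes "2 \<le> m" "0 < b"
  shows "\<not> real_rooted (monom 1 m + [:b:])"
proof
  assume rr: "real_rooted (monom 1 m + [:b:])"
  have nz: "monom 1 m + [:b:] \<noteq> 0"
  proof
    assume "monom 1 m + [:b:] = 0"
    then have "coeff (monom 1 m + [:b:]) 0 = 0" by simp
    with assms show False by simp
  qed
  define z where "z = complex_of_real (root m b) * cis (pi / real m)"
  have "z ^ m = complex_of_real (root m b ^ m) * cis (pi / real m) ^ m"
    by (simp add: z_def power_mult_distrib)
  also have "\<dots> = - complex_of_real b"
    using assms by (simp add: DeMoivre)
  finally have "poly (cpoly (monom 1 m + [:b:])) z = 0"
    by (simp add: cpoly_add map_poly_monom poly_monom map_poly_pCons)
  moreover have "0 < Im z"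
  proof -
    have "pi / real m < pi" using assms(1) pi_gt_zero by (simp add: divide_less_eq)
    then have "0 < sin (pi / real m)" using assms(1) by (intro sin_gt_zero) auto
    with assms show ?thesis by (simp add: z_def)
  qed
  ultimately show False using rr nz by (simp add: real_rooted_iff_upper_half_plane)
qed

lemma higher_pderiv_linear_power:
  "\<exists>K. K \<noteq> 0 \<and> (pderiv ^^ m) ([:- 1, 1 :: real:] ^ (m + d)) = smult K ([:- 1, 1:] ^ d)"
proof (induction m)
  case 0
  show ?case by (intro exI[of _ 1]) simp
next
  case (Suc m)
  then obtain K where K: "K \<noteq> 0" "(pderiv ^^ m) ([:- 1, 1 :: real:] ^ (m + d)) = smult K ([:- 1, 1:] ^ d)"
    by blast
  have "pderiv ([:- 1, 1 :: real:] ^ Suc (m + d)) = smult (real (Suc (m + d))) ([:- 1, 1:] ^ (m + d))"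
    by (simp only: pderiv_power_Suc) (simp add: pderiv_pCons del: power_Suc)
  then have "(pderiv ^^ Suc m) ([:- 1, 1 :: real:] ^ (Suc m + d)) = smult (real (Suc (m + d)) * K) ([:- 1, 1:] ^ d)"
    by (simp only: funpow_Suc_right o_apply add_Suc higher_pderiv_smult K(2) smult_smult)
  with K(1) show ?case by (intro exI[of _ "real (Suc (m + d)) * K"]) (simp del: of_nat_Suc)
qed

text \<open>The map below sends \<open>p\<close>, with \<open>(n - d)\<close>-th derivative \<open>r\<close>, to the quadratic polynomial
  whose discriminant is nonnegative by \<open>Newton_zero_sum\<close>.\<close>

definition newton_weights :: "nat \<Rightarrow> nat \<Rightarrow> nat \<Rightarrow> real" where
  "newton_weights n d k = pochhammer (real (Suc (d - k))) (n - d) *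
    (if k = d then 1 else if k = d - 1 then real d - 2
     else if k = d - 2 then (real d - 1) * (real d - 2) / 2 else 0)"

text \<open>The Pochhammer symbols in the weights are the factors of (n-d)-fold differentiation; the
  remaining factors act on the three lowest coefficients of the derivative.\<close>

lemma diag_map_newton_weights:
  assumes "2 \<le> d" "d \<le> n"
  defines "r \<equiv> \<lambda>p. (pderiv ^^ (n - d)) p"
  shows "diag_map n d (newton_weights n d) p =
    [:coeff (r p) 0, (real d - 2) * coeff (r p) 1, (real d - 1) * (real d - 2) / 2 * coeff (r p) 2:]"
proof (rule poly_eqI)
  fix j :: nat
  have r: "coeff (r p) i = pochhammer (real (Suc i)) (n - d) * coeff p (n - (d - i))" if "i \<le> 2" for i
  proof -
    have "n - (d - i) = i + (n - d)" using that assms(1,2) by auto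
    then show ?thesis by (simp add: r_def coeff_higher_pderiv)
  qed
  consider "j = 0" | "j = 1" | "j = 2" | "2 < j" "j \<le> d" | "d < j" by linarith
  then show "coeff (diag_map n d (newton_weights n d) p) j =
    coeff [:coeff (r p) 0, (real d - 2) * coeff (r p) 1, (real d - 1) * (real d - 2) / 2 * coeff (r p) 2:] j"
  proof cases
    case 2
    then have "d - (d - 1) = 1" "d - 1 \<noteq> d" using assms(1) by auto
    with 2 assms(1) r[of 1] show ?thesis by (simp add: coeff_diag_map newton_weights_def)
  next
    case 3
    then have "d - (d - 2) = 2" "d - 2 \<noteq> d" "d - 2 \<noteq> d - 1" using assms(1) by auto
    with 3 assms(1) r[of 2] show ?thesis
      by (simp add: coeff_diag_map newton_weights_def numeral_2_eq_2)
  next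
    case 4
    then have "d - j \<noteq> d" "d - j \<noteq> d - 1" "d - j \<noteq> d - 2" by auto
    with 4 show ?thesis by (auto simp: coeff_diag_map newton_weights_def coeff_pCons split: nat.splits)
  next
    case 5
    with assms(1) show ?thesis by (auto simp: coeff_diag_map coeff_pCons split: nat.splits)
  qed (use r[of 0] in \<open>simp add: coeff_diag_map newton_weights_def\<close>)
qed

lemma real_rooted_higher_pderiv: "real_rooted p \<Longrightarrow> real_rooted ((pderiv ^^ m) p)"
  by (induction m) (auto intro: real_rooted_pderiv)

text \<open>Differentiation keeps real roots and carries the vanishing coefficient from n - 1 to d -
  1. The discriminant condition of the image is d - 2 times the inequality of
  \<open>Newton_zero_sum\<close>.\<close>

lemma newton_weights_preserver:
  assumes d: "5 \<le> d" "d \<le> n" and p: "p \<in> hyp0 n"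
  shows "real_rooted (diag_map n d (newton_weights n d) p)"
proof -
  define r where "r = (pderiv ^^ (n - d)) p"
  have p': "real_rooted p" "degree p \<le> n" "coeff p (n - 1) = 0"
    using p d by (auto simp: hyp0_def polys_upto0_iff)
  have "coeff r (d - 1) = 0" using p'(3) d by (simp add: r_def coeff_higher_pderiv)
  moreover have "degree r \<le> d" using p'(2) d by (simp add: r_def degree_higher_pderiv)
  moreover have "real_rooted r" unfolding r_def by (rule real_rooted_higher_pderiv[OF p'(1)])
  ultimately have ineq: "2 * (real d - 1) * (coeff r 2 * coeff r 0) \<le> (real d - 2) * (coeff r 1)\<^sup>2"
    using d by (intro Newton_zero_sum) auto
  have "4 * ((real d - 1) * (real d - 2) / 2 * coeff r 2) * coeff r 0 =
      (real d - 2) * (2 * (real d - 1) * (coeff r 2 * coeff r 0))" by simp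
  also have "\<dots> \<le> (real d - 2) * ((real d - 2) * (coeff r 1)\<^sup>2)"
    using ineq d by (intro mult_left_mono) auto
  finally have disc: "4 * ((real d - 1) * (real d - 2) / 2 * coeff r 2) * coeff r 0 \<le> ((real d - 2) * coeff r 1)\<^sup>2"
    by (simp add: power2_eq_square mult_ac)
  have "real_rooted [:coeff r 0, (real d - 2) * coeff r 1, (real d - 1) * (real d - 2) / 2 * coeff r 2:]"
  proof (cases "(real d - 1) * (real d - 2) / 2 * coeff r 2 = 0")
    case True
    show ?thesis unfolding True by simp
  next
    case False
    from real_rooted_quadratic_iff[OF this] disc show ?thesis by blast
  qed
  then show ?thesis
    using diag_map_newton_weights[of d n p] d by (simp add: r_def)
qed

text \<open>An extension is determined by its weight \<open>c\<close> at index 1. If c = 0, it fails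
  on (t - 1)^n, where Newton's inequality is an equality and the sharpened one is false. If c
  \<noteq> 0, a suitable real-rooted polynomial goes to c t^2 (t^(d-3) + b) with b > 0.\<close>

lemma newton_weights_not_extendable:
  assumes d: "5 \<le> d" "d \<le> n"
  shows "\<not> extendable n d (diag_map n d (newton_weights n d))"
proof
  let ?\<gamma> = "newton_weights n d"
  assume "extendable n d (diag_map n d ?\<gamma>)"
  then obtain T' where T': "diagonal n d T'" "hyperbolicity_preserver n d T'"
    "\<And>p. p \<in> polys_upto0 n \<Longrightarrow> T' p = diag_map n d ?\<gamma> p"
    unfolding extendable_def by blast
  from T'(1) obtain c where c: "T' (monom 1 (n - 1)) = monom c (d - 1)"
    using d unfolding diagonal_def by (metis One_nat_def Suc_leI Suc_le_lessD le_trans numeral_le_one_iff one_le_numeral)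
  have lin: "linear_map_between (polys_upto n) (polys_upto d) T'"
    using T'(1) by (simp add: diagonal_def)
  have \<gamma>1: "?\<gamma> 1 = 0" using d by (auto simp: newton_weights_def)
  have T'_eq: "T' p = diag_map n d ?\<gamma> p + monom (coeff p (n - 1) * c) (d - 1)" if p: "degree p \<le> n" for p
  proof -
    define a where "a = coeff p (n - 1)"
    define p0 where "p0 = p - monom a (n - 1)"
    have m: "monom 1 (n - 1) \<in> polys_upto n" "monom a (n - 1) \<in> polys_upto n"
      using degree_monom_le[of "1::real" "n - 1"] degree_monom_le[of a "n - 1"]
      by (auto simp: polys_upto_def)
    have p0: "p0 \<in> polys_upto0 n"
      using p m(2) d by (auto simp: polys_upto0_iff p0_def a_def polys_upto_def intro!: degree_diff_le)
    then have p0': "p0 \<in> polys_upto n" by (simp add: polys_upto0_def)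
    have "T' (p0 + smult a (monom 1 (n - 1))) = T' p0 + smult a (T' (monom 1 (n - 1)))"
    proof -
      have "smult a (monom 1 (n - 1)) \<in> polys_upto n" using m(2) by (simp add: smult_monom)
      with lin m(1) p0' show ?thesis by (simp add: linear_map_between_def)
    qed
    moreover have "p0 + smult a (monom 1 (n - 1)) = p" by (simp add: p0_def smult_monom)
    moreover have "diag_map n d ?\<gamma> p0 = diag_map n d ?\<gamma> p"
    proof -
      have "diag_map n d ?\<gamma> p = diag_map n d ?\<gamma> p0 + diag_map n d ?\<gamma> (monom a (n - 1))"
        by (simp add: p0_def flip: diag_map_add)
      moreover have "diag_map n d ?\<gamma> (monom a (n - 1)) = 0"
        using d \<gamma>1 diag_map_monom[of d n 1 ?\<gamma> a] by simp
      ultimately show ?thesis by simp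
    qed
    ultimately show ?thesis
      unfolding T'(3)[OF p0] c by (simp only: smult_monom a_def)
  qed
  have pres: "real_rooted (T' p)" if "degree p \<le> n" "real_rooted p" for p
    using T'(2) that by (simp add: hyperbolicity_preserver_def polys_upto_def)
  show False
  proof (cases "c = 0")
    case True
    define p where "p = [:- 1, 1 :: real:] ^ n"
    obtain K where K: "K \<noteq> 0" "(pderiv ^^ (n - d)) p = smult K ([:- 1, 1:] ^ d)"
      using higher_pderiv_linear_power[of "n - d" d] d by (auto simp: p_def)
    define s where "s = K * (- 1) ^ d"
    have s: "s \<noteq> 0" using K by (simp add: s_def)
    have coe: "coeff ((pderiv ^^ (n - d)) p) i = s * ((- 1) ^ i * real (d choose i))" if "i \<le> d" for i
    proof -
      have "(- 1) ^ (d - i) = ((- 1) ^ d * (- 1) ^ i :: real)"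
        using that by (auto simp: minus_one_power_iff)
      then show ?thesis
        using coeff_linear_poly_power[of i d "- 1" "1::real"] that by (simp add: K(2) s_def)
    qed
    have "real (d choose 2) = real d * (real d - 1) / 2"
    proof -
      have "2 * (d choose 2) = d * (d - 1)" by (cases "even d") (auto simp: choose_two)
      then have "2 * real (d choose 2) = real d * real (d - 1)" by (metis of_nat_mult of_nat_numeral)
      with d show ?thesis by (simp add: of_nat_diff)
    qed
    then have "diag_map n d ?\<gamma> p =
        [:s, (real d - 2) * (- s * real d), (real d - 1) * (real d - 2) / 2 * (s * (real d * (real d - 1) / 2)):]"
      using coe[of 0] coe[of 1] coe[of 2] d by (simp add: diag_map_newton_weights)
    moreover have "real_rooted (diag_map n d ?\<gamma> p)"
      using pres[of p] T'_eq[of p] True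
      by (simp add: p_def degree_power_eq real_rooted_power)
    moreover have "(real d - 1) * (real d - 2) / 2 * (s * (real d * (real d - 1) / 2)) \<noteq> 0"
      using s d by auto
    ultimately have "4 * ((real d - 1) * (real d - 2) / 2 * (s * (real d * (real d - 1) / 2))) * s \<le> ((real d - 2) * (- s * real d))\<^sup>2"
      by (metis real_rooted_quadratic_iff)
    \<comment> \<open>With A = d - 1, B = d - 2 and C = d, the discriminant condition reduces to (d
      - 1)^2 \<le> d (d - 2), which is off by one.\<close>
    moreover have "4 * (A * B / 2 * (s * (C * A / 2))) * s = s\<^sup>2 * (C * B) * A\<^sup>2"
      "(B * (- s * C))\<^sup>2 = s\<^sup>2 * (C * B) * (C * B)" for A B C :: real
      by (simp_all add: power2_eq_square)
    ultimately have "s\<^sup>2 * (real d * (real d - 2)) * (real d - 1)\<^sup>2 \<le> s\<^sup>2 * (real d * (real d - 2)) * (real d * (real d - 2))"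
      by (simp only:)
    moreover have "0 < s\<^sup>2 * (real d * (real d - 2))" using s d by simp
    ultimately have "(real d - 1)\<^sup>2 \<le> real d * (real d - 2)"
      by (metis mult_le_cancel_left_pos)
    then show False by (simp add: power2_eq_square algebra_simps)
  next
    case False
    \<comment> \<open>Here d \<ge> 5 matters: it makes m at least 2, so that t^m plus a positive
      constant has nonreal roots.\<close>
    define m where "m = d - 3"
    have m: "2 \<le> m" "d - 1 = m + 2" using d by (auto simp: m_def)
    \<comment> \<open>The last root is chosen to make the constant coefficient \<open>sgn c\<close>.
      In \<open>p\<close>, the power of t places this coefficient at the weight of index d - 2,
      leaves nothing for the two later weights, and lets the leading coefficient 1 meet
      \<open>c\<close>.\<close>
    define q where "q = [:- 1, 1:] ^ (m - 1) * [:- ((- 1) ^ m * sgn c), 1:]"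
    define p where "p = monom 1 (n - d + 2) * q"
    have deg_q: "degree q = m"
      using m by (simp add: q_def degree_mult_eq degree_power_eq del: mult_pCons_right)
    have "lead_coeff q = 1" by (simp add: q_def lead_coeff_mult lead_coeff_power del: mult_pCons_right)
    then have lead: "coeff q m = 1" by (simp add: deg_q)
    have "poly q 0 = (- 1) ^ (m - 1) * (- ((- 1) ^ m * sgn c))" by (simp add: q_def del: mult_pCons_right)
    also have "\<dots> = sgn c" using m by (cases m) simp_all
    finally have q0: "coeff q 0 = sgn c" by (simp add: poly_0_coeff_0)
    have deg_p: "degree p \<le> n"
      unfolding p_def using d m deg_q by (intro order_trans[OF degree_mult_le]) (simp add: degree_monom_eq m_def)
    have "real_rooted p"
      unfolding p_def q_def by (intro real_rooted_mult real_rooted_power real_rooted_monom real_rooted_linear)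
    then have rr: "real_rooted (T' p)" using pres deg_p by blast
    have "n - 1 - (n - d + 2) = m" "\<not> n - 1 < n - d + 2" using d by (auto simp: m_def)
    then have p1: "coeff p (n - 1) = 1" by (simp add: p_def coeff_monom_mult lead)
    have \<gamma>2: "0 < ?\<gamma> (d - 2)"
      using d by (auto simp: newton_weights_def intro!: mult_pos_pos pochhammer_pos)
    have "diag_map n d ?\<gamma> p = monom (?\<gamma> (d - 2) * sgn c) 2"
    proof (rule poly_eqI)
      fix j
      show "coeff (diag_map n d ?\<gamma> p) j = coeff (monom (?\<gamma> (d - 2) * sgn c) 2) j"
      proof (cases "2 < j \<and> j \<le> d")
        case True
        then have "d - j \<noteq> d" "d - j \<noteq> d - 1" "d - j \<noteq> d - 2" by auto
        with True show ?thesis by (simp add: coeff_diag_map newton_weights_def)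
      next
        case False
        have *: "n - (d - j) < n - d + 2" if "j < 2" using that d by auto
        have "n - (d - 2) = n - d + 2" using d by auto
        with False * show ?thesis
          using d by (auto simp: coeff_diag_map p_def coeff_monom_mult q0)
      qed
    qed
    then have "T' p = monom (?\<gamma> (d - 2) * sgn c) 2 + monom c (m + 2)"
      using T'_eq[OF deg_p] p1 m by simp
    also have "\<dots> = smult c (monom 1 2 * (monom 1 m + [:?\<gamma> (d - 2) * \<bar>c\<bar> / c\<^sup>2:]))"
    proof -
      have "c * (?\<gamma> (d - 2) * \<bar>c\<bar> / c\<^sup>2) = ?\<gamma> (d - 2) * sgn c"
        using False by (simp add: sgn_if power2_eq_square)
      moreover have "monom 1 2 * [:b:] = monom b 2" for b :: real by (simp add: smult_monom)
      ultimately show ?thesis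
        by (simp only: distrib_left smult_add_right smult_monom mult_monom mult_1 mult_1_right add.commute)
    qed
    finally have "real_rooted (monom 1 m + [:?\<gamma> (d - 2) * \<bar>c\<bar> / c\<^sup>2:])"
      using rr False by (simp only: real_rooted_smult_iff real_rooted_monom_mult_iff simp_thms)
    moreover have "0 < ?\<gamma> (d - 2) * \<bar>c\<bar> / c\<^sup>2" using \<gamma>2 False by simp
    ultimately show False using not_real_rooted_monom_plus_const m(1) by blast
  qed
qed

section \<open>Assembling both halves\<close>

lemma diag_map_polys_upto0:
  assumes "\<gamma> 1 = 0"
  shows "diag_map n d \<gamma> p \<in> polys_upto0 d"
  using assms by (auto simp: polys_upto0_def polys_upto_def degree_diag_map_le coeff_diag_map)

lemma exists_not_extendable_preserver:
  assumes "5 \<le> d" "d \<le> n"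
  shows "\<exists>T. diagonal0 n d T \<and> zero_sum_hyperbolicity_preserver n d T \<and> \<not> extendable n d T"
proof (intro exI conjI)
  let ?T = "diag_map n d (newton_weights n d)"
  have "newton_weights n d 1 = 0" using assms by (auto simp: newton_weights_def)
  then have into: "?T p \<in> polys_upto0 d" for p by (rule diag_map_polys_upto0)
  then have lin: "linear_map_between (polys_upto0 n) (polys_upto0 d) ?T"
    by (auto simp: linear_map_between_def diag_map_add diag_map_smult)
  with assms show "diagonal0 n d ?T"
    by (auto simp: diagonal0_def diag_map_monom intro!: exI[of _ "newton_weights n d"])
  show "zero_sum_hyperbolicity_preserver n d ?T"
    using lin newton_weights_preserver[OF assms] into
    by (auto simp: zero_sum_hyperbolicity_preserver_def hyp0_def)
  show "\<not> extendable n d ?T" by (rule newton_weights_not_extendable[OF assms])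
qed

text \<open>Necessity evaluates the map at two test polynomials; sufficiency restricts the preserver
  built in \<open>diag_map_extension\<close>, which gives extendability as well.\<close>

lemma preserver_test:
  assumes n: "1 \<le> n" "d \<le> n" "d \<le> 4" and T: "diagonal0 n d T"
  defines "q \<equiv> T ([:- 1, 1:] ^ (n - 1) * [:real n - 1, 1:])"
  shows "zero_sum_hyperbolicity_preserver n d T \<longleftrightarrow> real_rooted q \<and> all_but_one_root_same_sign d q"
    and "zero_sum_hyperbolicity_preserver n d T \<Longrightarrow> extendable n d T"
proof -
  let ?f = "[:- 1, 1:] ^ (n - 1) * [:real n - 1, 1:]"
  obtain \<gamma> where \<gamma>: "\<gamma> 1 = 0" "\<And>p. p \<in> polys_upto0 n \<Longrightarrow> T p = diag_map n d \<gamma> p"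
    using diagonal0_eq_diag_map[OF n(1,2) T] by blast
  have q: "q = diag_map n d \<gamma> ?f"
    unfolding q_def using test_poly_in_hyp0[OF n(1)] by (intro \<gamma>(2)) (simp add: hyp0_def)
  have lin: "linear_map_between (polys_upto0 n) (polys_upto0 d) T"
    using T by (simp add: diagonal0_def)
  have necessary: "real_rooted q \<and> all_but_one_root_same_sign d q"
    if pres: "zero_sum_hyperbolicity_preserver n d T"
  proof
    show "real_rooted q"
      using pres test_poly_in_hyp0[OF n(1)]
      by (auto simp: q_def zero_sum_hyperbolicity_preserver_def hyp0_def)
    have "diag_map n d \<gamma> p \<in> hyp0 d" if "p \<in> hyp0 n" for p
      using pres that \<gamma>(2)[of p] by (auto simp: zero_sum_hyperbolicity_preserver_def hyp0_def)
    then show "all_but_one_root_same_sign d q"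
      unfolding q by (rule preserver_sign_condition[OF n])
  qed
  have sufficient: "zero_sum_hyperbolicity_preserver n d T \<and> extendable n d T"
    if "real_rooted q \<and> all_but_one_root_same_sign d q"
  proof -
    have "real_rooted (diag_map n d \<gamma> ?f)" "all_but_one_root_same_sign d (diag_map n d \<gamma> ?f)"
      using that by (simp_all only: q)
    then obtain \<gamma>' where \<gamma>': "\<And>k. k \<noteq> 1 \<Longrightarrow> \<gamma>' k = \<gamma> k"
      "\<And>p. real_rooted p \<Longrightarrow> degree p \<le> n \<Longrightarrow> real_rooted (diag_map n d \<gamma>' p)"
      by (rule diag_map_extension[where \<gamma> = \<gamma>, OF n \<gamma>(1)]) blast
    have agree: "diag_map n d \<gamma>' p = T p" if "p \<in> polys_upto0 n" for p
    proof -
      have "coeff p (n - 1) = 0" using that n by (simp add: polys_upto0_iff)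
      then have "\<gamma>' k * coeff p (n - k) = \<gamma> k * coeff p (n - k)" for k
        using \<gamma>'(1)[of k] by (cases "k = 1") auto
      then show ?thesis by (simp only: \<gamma>(2)[OF that] diag_map_def)
    qed
    have "T p \<in> hyp0 d" if "p \<in> hyp0 n" for p
    proof -
      from that have p: "p \<in> polys_upto0 n" "real_rooted p" "degree p \<le> n"
        by (auto simp: hyp0_def polys_upto0_def polys_upto_def)
      moreover have "T p \<in> polys_upto0 d" using lin p(1) by (simp add: linear_map_between_def)
      ultimately show ?thesis using \<gamma>'(2)[of p] by (simp add: agree hyp0_def)
    qed
    then have "zero_sum_hyperbolicity_preserver n d T"
      using lin by (auto simp: zero_sum_hyperbolicity_preserver_def)
    moreover have "extendable n d T"
      unfolding extendable_def hyperbolicity_preserver_def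
      using diagonal_diag_map[OF n(2), of \<gamma>'] linear_map_between_diag_map[of n d \<gamma>'] \<gamma>'(2) agree
      by (intro exI[of _ "diag_map n d \<gamma>'"]) (auto simp: polys_upto_def)
    ultimately show ?thesis ..
  qed
  show "zero_sum_hyperbolicity_preserver n d T \<longleftrightarrow> real_rooted q \<and> all_but_one_root_same_sign d q"
    using necessary sufficient by blast
  show "extendable n d T" if "zero_sum_hyperbolicity_preserver n d T"
    using necessary sufficient that by blast
qed

theorem theorem1p8:
  fixes n d :: nat
  assumes "1 \<le> n" and "d \<le> n"
  shows "(d \<le> 4 \<longrightarrow>
            (\<forall>T. diagonal0 n d T \<and> zero_sum_hyperbolicity_preserver n d T \<longrightarrow> extendable n d T) \<and>
            (\<forall>T. diagonal0 n d T \<longrightarrow>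
               (let q = T ([:-1, 1:] ^ (n - 1) * [:real n - 1, 1:]) in
                 (zero_sum_hyperbolicity_preserver n d T \<longleftrightarrow>
                    real_rooted q \<and> all_but_one_root_same_sign d q) \<and>
                 (zero_sum_hyperbolicity_preserver n d T \<and> extendable n d T \<longleftrightarrow>
                    real_rooted q \<and> all_but_one_root_same_sign d q)))) \<and>
         (5 \<le> d \<longrightarrow>
            (\<exists>T. diagonal0 n d T \<and> zero_sum_hyperbolicity_preserver n d T \<and>
                 \<not> extendable n d T))"
  unfolding Let_def using preserver_test[OF assms] exists_not_extendable_preserver[OF _ assms(2)] by blast

end
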